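(* Assume the following principle (K): for every atomic base $\mathfrak{B}$ and every ground $g$ on $\mathfrak{B}$ for an assertion $\alpha_1,\dots,\alpha_n\vdash\beta$ ($n\ge 0$), there are a language of grounding $\Lambda$ on $\mathfrak{B}$, a denotation function $den^*$ for the alphabet of $\Lambda$ with associated term denotation $den$, and a term $U:\beta$ of $\Lambda$ such that $den(U)\approx_\mathfrak{B} g$. Then, given a language of grounding $\Lambda_1$ over an atomic base $\mathfrak{B}$ with atomic system $\texttt{S}$, a denotation $den^*_1$ for the alphabet of $\Lambda_1$ (with associated $den_1$), and a closed term $T$ of $\Lambda_1$, there is an expansion $\Lambda_2$ of $\Lambda_1$ on $\mathfrak{B}$ such that, for some denotation $den^*_2$ for the alphabet of $\Lambda_2$ (with associated $den_2$), $den_1(T)\approx_\mathfrak{B} den_2(T)$ and $\Lambda_2$ is closed under canonical form relative to $den_2$ with respect to $T$.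
   Context: Background: $L$ is a first-order language with $\bot,\wedge,\vee,\rightarrow,\forall,\exists$. An atomic base $\mathfrak{B}$ on $L$ consists of the constants of $L$ and an atomic system $\texttt{S}$ (a recursively axiomatisable set of rules from atomic premises other than $\bot$ to an atomic conclusion or $\bot$), with an associated domain of individuals $D_\mathfrak{B}$. Grounds on $\mathfrak{B}$ for closed $\alpha$: closed derivations in $\texttt{S}$ for atomic $\alpha$; $\wedge I(g_1,g_2)$, $\vee I(g)$, $\rightarrow I\xi^\alpha(f)$ (with $f$ a ground for $\alpha\vdash\beta$), $\exists I(g)$, $\forall Ix(f)$ (with $f$ a ground for $\vdash\alpha(x)$) built from grounds for the immediate components; none for $\bot$; nothing else. Grounds for open/hypothetical assertions $\Gamma\vdash\beta$ are $\mathfrak{B}$-operations on grounds: total constructive functions, fixed by defining equations, mapping individuals of $D_\mathfrak{B}$ and grounds for the closed instances of $\Gamma$ to grounds for the corresponding closed instance of $\beta$ (second-level operations may also take first-level operations as arguments and bind variables). Equivalence $g_1\equiv_\mathfrak{B}g_2$: same operational type and number of individual arguments, and for closed grounds the same derivation or the same outermost primitive operation applied to equivalent components, for operations identical values on identical arguments. Identity $g_1\approx_\mathfrak{B}g_2$: same type and arity, and either the same atomic derivation or built from operations defined by the same equations (same computation instructions) applied to identical arguments; $\approx_\mathfrak{B}$ implies $\equiv_\mathfrak{B}$. A language of grounding $\Lambda$ over $\mathfrak{B}$ has individual constants $\delta_i$ naming the closed derivations of $\texttt{S}$, typed variables $\xi^\alpha_i$, and operational symbols $F[\tau]$ (labels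 attached to operational types $\tau$, possibly binding variables), each required to have some $\mathfrak{B}$-operation on grounds of its type with the same bindings; typed terms are $\delta$, $\xi^\alpha$, and $\phi\,\underline{x}\,\underline{\xi}(U_1,\dots,U_n)$ formed according to the type of $\phi$. $\mathbb{F}_\Lambda$ is its set of operational symbols. Primitive symbols are $\wedge I,\vee I,\rightarrow I,\exists I,\forall I,\bot_\alpha$. A denotation $den^*$ for the alphabet maps $\delta_i$ to the named derivation, $\xi^\alpha$ to the identity operation of type $\alpha\rhd\alpha$, primitive symbols to the primitive operations, and each non-primitive symbol to some $\mathfrak{B}$-operation on grounds of its type; the associated $den$ is $den(\phi\,\underline{x}\,\underline{\xi}(U_1,\dots,U_n))=den^*(\phi)(\underline{y},den(U_1),\dots,den(U_n))$, $den(\delta)=den^*(\delta)$, $den(\xi^\alpha)=den^*(\xi^\alpha)$. An expansion of $\Lambda_1$ over $\mathfrak{B}_1$ is a language of grounding $\Lambda_2$ over an expansion $\mathfrak{B}_2$ of $\mathfrak{B}_1$ (here $\mathfrak{B}_2=\mathfrak{B}$) with $\mathbb{F}_{\Lambda_1}\subseteq\mathbb{F}_{\Lambda_2}$. A term is canonical iff it is an individual constant, a typed variable, or its outermost operational symbol is one of $\wedge I,\vee I,\rightarrow I,\exists I,\forall I$. $\Lambda$ is closed under canonical form relative to $den$ with respect to a closed term $T$ iff there is a closed canonical term $U$ of $\Lambda$ with $den(T)\equiv_\mathfrak{B}den(U)$. *)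

theory Defs
  imports Main "HOL-Library.Nat_Bijection"
begin

section \<open>First-order languages\<close>

text \<open>
  Formulas are locally nameless: free individual variables are named (\<open>Var\<close>), bound ones are
  de Bruijn indices (\<open>Bnd\<close>) counting quantifiers. Formulas are thus identified up to renaming
  of bound variables.  Individual constants are function symbols of arity 0.
\<close>

datatype tm = Var nat | Bnd nat | Fn nat "tm list"

datatype fm =
    Falsum
  | Atom nat "tm list"
  | Conj fm fm
  | Disj fm fm
  | Impl fm fm
  | Forall fm
  | Exists fm

record language =
  fun_syms :: "(nat \<times> nat) set"
  pred_syms :: "(nat \<times> nat) set"

primrec fv_tm :: "tm \<Rightarrow> nat set" where
  "fv_tm (Var x) = {x}"
| "fv_tm (Bnd i) = {}"
| "fv_tm (Fn f ts) = \<Union> (set (map fv_tm ts))"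

primrec fv :: "fm \<Rightarrow> nat set" where
  "fv Falsum = {}"
| "fv (Atom p ts) = \<Union> (set (map fv_tm ts))"
| "fv (Conj a b) = fv a \<union> fv b"
| "fv (Disj a b) = fv a \<union> fv b"
| "fv (Impl a b) = fv a \<union> fv b"
| "fv (Forall a) = fv a"
| "fv (Exists a) = fv a"

text \<open>\<open>wf_tm L k\<close> and \<open>wf_fm L k\<close>: over the symbols of \<open>L\<close>, with loose indices below \<open>k\<close>.\<close>

primrec wf_tm :: "language \<Rightarrow> nat \<Rightarrow> tm \<Rightarrow> bool" where
  "wf_tm L k (Var x) = True"
| "wf_tm L k (Bnd i) = (i < k)"
| "wf_tm L k (Fn f ts) = ((f, length ts) \<in> fun_syms L \<and> list_all id (map (wf_tm L k) ts))"

primrec wf_fm :: "language \<Rightarrow> nat \<Rightarrow> fm \<Rightarrow> bool" where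
  "wf_fm L k Falsum = True"
| "wf_fm L k (Atom p ts) = ((p, length ts) \<in> pred_syms L \<and> list_all (wf_tm L k) ts)"
| "wf_fm L k (Conj a b) = (wf_fm L k a \<and> wf_fm L k b)"
| "wf_fm L k (Disj a b) = (wf_fm L k a \<and> wf_fm L k b)"
| "wf_fm L k (Impl a b) = (wf_fm L k a \<and> wf_fm L k b)"
| "wf_fm L k (Forall a) = wf_fm L (Suc k) a"
| "wf_fm L k (Exists a) = wf_fm L (Suc k) a"

abbreviation formula :: "language \<Rightarrow> fm \<Rightarrow> bool" where
  "formula L \<equiv> wf_fm L 0"

text \<open>Simultaneous substitution for the free individual variables; it is only used with
  terms without loose indices, so no lifting is needed under quantifiers.\<close>

primrec subst_tm :: "(nat \<Rightarrow> tm) \<Rightarrow> tm \<Rightarrow> tm" where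
  "subst_tm \<sigma> (Var x) = \<sigma> x"
| "subst_tm \<sigma> (Bnd i) = Bnd i"
| "subst_tm \<sigma> (Fn f ts) = Fn f (map (subst_tm \<sigma>) ts)"

primrec subst :: "(nat \<Rightarrow> tm) \<Rightarrow> fm \<Rightarrow> fm" where
  "subst \<sigma> Falsum = Falsum"
| "subst \<sigma> (Atom p ts) = Atom p (map (subst_tm \<sigma>) ts)"
| "subst \<sigma> (Conj a b) = Conj (subst \<sigma> a) (subst \<sigma> b)"
| "subst \<sigma> (Disj a b) = Disj (subst \<sigma> a) (subst \<sigma> b)"
| "subst \<sigma> (Impl a b) = Impl (subst \<sigma> a) (subst \<sigma> b)"
| "subst \<sigma> (Forall a) = Forall (subst \<sigma> a)"
| "subst \<sigma> (Exists a) = Exists (subst \<sigma> a)"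

text \<open>\<open>inst a t\<close> is the instance by \<open>t\<close> of the outermost bound variable of \<open>Forall a\<close>
  or \<open>Exists a\<close>.\<close>

primrec inst_tm :: "nat \<Rightarrow> tm \<Rightarrow> tm \<Rightarrow> tm" where
  "inst_tm k u (Var x) = Var x"
| "inst_tm k u (Bnd i) = (if i = k then u else Bnd i)"
| "inst_tm k u (Fn f ts) = Fn f (map (inst_tm k u) ts)"

primrec inst_fm :: "nat \<Rightarrow> tm \<Rightarrow> fm \<Rightarrow> fm" where
  "inst_fm k u Falsum = Falsum"
| "inst_fm k u (Atom p ts) = Atom p (map (inst_tm k u) ts)"
| "inst_fm k u (Conj a b) = Conj (inst_fm k u a) (inst_fm k u b)"
| "inst_fm k u (Disj a b) = Disj (inst_fm k u a) (inst_fm k u b)"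
| "inst_fm k u (Impl a b) = Impl (inst_fm k u a) (inst_fm k u b)"
| "inst_fm k u (Forall a) = Forall (inst_fm (Suc k) u a)"
| "inst_fm k u (Exists a) = Exists (inst_fm (Suc k) u a)"

abbreviation inst :: "fm \<Rightarrow> tm \<Rightarrow> fm" where
  "inst a u \<equiv> inst_fm 0 u a"

primrec degree :: "fm \<Rightarrow> nat" where
  "degree Falsum = 0"
| "degree (Atom p ts) = 0"
| "degree (Conj a b) = Suc (degree a + degree b)"
| "degree (Disj a b) = Suc (degree a + degree b)"
| "degree (Impl a b) = Suc (degree a + degree b)"
| "degree (Forall a) = Suc (degree a)"
| "degree (Exists a) = Suc (degree a)"

lemma degree_inst_fm [simp]: "degree (inst_fm k u a) = degree a"
  by (induction a arbitrary: k) auto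


section \<open>Recursive functions\<close>

datatype recf =
    Zero
  | Succ
  | Proj nat
  | Comp recf "recf list"
  | PrimRec recf recf
  | Mu recf

inductive reval :: "recf \<Rightarrow> nat list \<Rightarrow> nat \<Rightarrow> bool" where
  "reval Zero ns 0"
| "reval Succ (n # ns) (Suc n)"
| "i < length ns \<Longrightarrow> reval (Proj i) ns (ns ! i)"
| "list_all2 (\<lambda>r m. reval r ns m) rs ms \<Longrightarrow> reval r ms n \<Longrightarrow> reval (Comp r rs) ns n"
| "reval r ns m \<Longrightarrow> reval (PrimRec r s) (0 # ns) m"
| "reval (PrimRec r s) (n # ns) m \<Longrightarrow> reval s (n # m # ns) k \<Longrightarrow> reval (PrimRec r s) (Suc n # ns) k"
| "\<forall>m<n. \<exists>k. reval r (m # ns) (Suc k) \<Longrightarrow> reval r (n # ns) 0 \<Longrightarrow> reval (Mu r) ns n"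

primrec code_tm :: "tm \<Rightarrow> nat" where
  "code_tm (Var x) = prod_encode (0, x)"
| "code_tm (Bnd i) = prod_encode (1, i)"
| "code_tm (Fn f ts) = prod_encode (2, prod_encode (f, list_encode (map code_tm ts)))"

primrec code_fm :: "fm \<Rightarrow> nat" where
  "code_fm Falsum = prod_encode (0, 0)"
| "code_fm (Atom p ts) = prod_encode (1, prod_encode (p, list_encode (map code_tm ts)))"
| "code_fm (Conj a b) = prod_encode (2, prod_encode (code_fm a, code_fm b))"
| "code_fm (Disj a b) = prod_encode (3, prod_encode (code_fm a, code_fm b))"
| "code_fm (Impl a b) = prod_encode (4, prod_encode (code_fm a, code_fm b))"
| "code_fm (Forall a) = prod_encode (5, code_fm a)"
| "code_fm (Exists a) = prod_encode (6, code_fm a)"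


section \<open>Atomic bases\<close>

type_synonym rule = "fm list \<times> fm"

definition code_rule :: "rule \<Rightarrow> nat" where
  "code_rule r = prod_encode (list_encode (map code_fm (fst r)), code_fm (snd r))"

definition recursive_rules :: "rule set \<Rightarrow> bool" where
  "recursive_rules R \<longleftrightarrow> (\<exists>r. \<forall>\<rho>. reval r [code_rule \<rho>] (if \<rho> \<in> R then 1 else 0))"

definition atomic_formula :: "language \<Rightarrow> fm \<Rightarrow> bool" where
  "atomic_formula L a \<longleftrightarrow> formula L a \<and> (\<exists>p ts. a = Atom p ts)"

record base =
  base_lang :: language
  base_rules :: "rule set"

text \<open>
  The individuals are identified with their names.  Closed instances of formulas are formed by
  putting names of individuals for variables, and every closed term has to name an individual
  (\<open>\<exists>\<close>-elimination, say, passes a witness term on to an operation on individuals); so the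
  domain of a base is the set of its closed terms.
\<close>

definition individuals :: "base \<Rightarrow> tm set" where
  "individuals B = {t. wf_tm (base_lang B) 0 t \<and> fv_tm t = {}}"

text \<open>
  \<open>base_rules B\<close> is the recursive axiomatisation of the atomic system: the rules may contain
  free individual variables and are then schemata for all their instances.
\<close>

definition base_on :: "language \<Rightarrow> base \<Rightarrow> bool" where
  "base_on L B \<longleftrightarrow>
     base_lang B = L \<and>
     individuals B \<noteq> {} \<and>
     (\<forall>(ps, c) \<in> base_rules B.
        (\<forall>p \<in> set ps. atomic_formula L p) \<and> (atomic_formula L c \<or> c = Falsum)) \<and>
     recursive_rules (base_rules B)"

datatype deriv = Infer fm "deriv list"

primrec concl :: "deriv \<Rightarrow> fm" where
  "concl (Infer a ds) = a"

inductive closed_deriv :: "base \<Rightarrow> deriv \<Rightarrow> bool" for B where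
  "(ps, c) \<in> base_rules B \<Longrightarrow> \<forall>x. \<sigma> x \<in> individuals B \<Longrightarrow>
   map concl ds = map (subst \<sigma>) ps \<Longrightarrow> \<forall>d \<in> set ds. closed_deriv B d \<Longrightarrow>
   closed_deriv B (Infer (subst \<sigma> c) ds)"

primrec code_deriv :: "deriv \<Rightarrow> nat" where
  "code_deriv (Infer a ds) = prod_encode (code_fm a, list_encode (map code_deriv ds))"


section \<open>Computation instructions\<close>

text \<open>
  Grounds and operations on grounds are given by expressions which say how they are computed:
  an operation \<open>F\<close> with argument places \<open>p\<^sub>1, \<dots>, p\<^sub>n\<close> is given by the right-hand side of its defining
  equation \<open>F(p\<^sub>1, \<dots>, p\<^sub>n) = e\<close>.  The expressions are those of an untyped call-by-name
  lambda calculus (hence with general recursion) with the primitive operations, case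
  distinction on them, and all partial recursive functions on the finite data, that is, on
  individuals and atomic derivations.  So the functions fixed by equations of this kind are
  the effectively computable ones, and a constructive function is one of them that is total on
  the arguments of its operational type.

  Lambda-bound variables are de Bruijn indices (\<open>Idx\<close>); \<open>Place p\<close> is an argument place, so that
  composition of operations is substitution for places.  \<open>EFn\<close> is the application of
  a function symbol to individuals.
\<close>

datatype datum = Ind tm | Der deriv

primrec code_datum :: "datum \<Rightarrow> nat" where
  "code_datum (Ind t) = prod_encode (0, code_tm t)"
| "code_datum (Der d) = prod_encode (1, code_deriv d)"

datatype (places: 'p) exp =
    Place 'p
  | Idx nat
  | Lam "'p exp"
  | App "'p exp" "'p exp"
  | Dat datum
  | EFn nat "'p exp list"
  | EAnd "'p exp" "'p exp"
  | EOrL "'p exp"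
  | EOrR "'p exp"
  | EImp "'p exp"
  | EAll "'p exp"
  | EEx "'p exp" "'p exp"
  | EBot "'p exp"
  | CaseAnd "'p exp" "'p exp"
  | CaseOr "'p exp" "'p exp" "'p exp"
  | CaseImp "'p exp" "'p exp"
  | CaseAll "'p exp" "'p exp"
  | CaseEx "'p exp" "'p exp"
  | Rec recf "'p exp list"
  | IfEq "'p exp" "'p exp" "'p exp" "'p exp"

primrec lc :: "nat \<Rightarrow> 'p exp \<Rightarrow> bool" where
  "lc k (Place p) = True"
| "lc k (Idx i) = (i < k)"
| "lc k (Lam e) = lc (Suc k) e"
| "lc k (App e f) = (lc k e \<and> lc k f)"
| "lc k (Dat d) = True"
| "lc k (EFn g es) = list_all id (map (lc k) es)"
| "lc k (EAnd e f) = (lc k e \<and> lc k f)"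
| "lc k (EOrL e) = lc k e"
| "lc k (EOrR e) = lc k e"
| "lc k (EImp e) = lc k e"
| "lc k (EAll e) = lc k e"
| "lc k (EEx e f) = (lc k e \<and> lc k f)"
| "lc k (EBot e) = lc k e"
| "lc k (CaseAnd e f) = (lc k e \<and> lc k f)"
| "lc k (CaseOr e f g) = (lc k e \<and> lc k f \<and> lc k g)"
| "lc k (CaseImp e f) = (lc k e \<and> lc k f)"
| "lc k (CaseAll e f) = (lc k e \<and> lc k f)"
| "lc k (CaseEx e f) = (lc k e \<and> lc k f)"
| "lc k (Rec r es) = list_all id (map (lc k) es)"
| "lc k (IfEq d e f g) = (lc k d \<and> lc k e \<and> lc k f \<and> lc k g)"

definition closed_exp :: "'p exp \<Rightarrow> bool" where
  "closed_exp e \<longleftrightarrow> lc 0 e \<and> places e = {}"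

text \<open>\<open>open_exp k u\<close> puts \<open>u\<close> for the index \<open>k\<close>, \<open>close_exp k p\<close> turns the place \<open>p\<close> into the index \<open>k\<close>,
  and \<open>plug\<close> fills the places.  The expressions put in are without loose indices.\<close>

primrec open_exp :: "nat \<Rightarrow> 'p exp \<Rightarrow> 'p exp \<Rightarrow> 'p exp" where
  "open_exp k u (Place p) = Place p"
| "open_exp k u (Idx i) = (if i = k then u else Idx i)"
| "open_exp k u (Lam e) = Lam (open_exp (Suc k) u e)"
| "open_exp k u (App e f) = App (open_exp k u e) (open_exp k u f)"
| "open_exp k u (Dat d) = Dat d"
| "open_exp k u (EFn g es) = EFn g (map (open_exp k u) es)"
| "open_exp k u (EAnd e f) = EAnd (open_exp k u e) (open_exp k u f)"
| "open_exp k u (EOrL e) = EOrL (open_exp k u e)"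
| "open_exp k u (EOrR e) = EOrR (open_exp k u e)"
| "open_exp k u (EImp e) = EImp (open_exp k u e)"
| "open_exp k u (EAll e) = EAll (open_exp k u e)"
| "open_exp k u (EEx e f) = EEx (open_exp k u e) (open_exp k u f)"
| "open_exp k u (EBot e) = EBot (open_exp k u e)"
| "open_exp k u (CaseAnd e f) = CaseAnd (open_exp k u e) (open_exp k u f)"
| "open_exp k u (CaseOr e f g) = CaseOr (open_exp k u e) (open_exp k u f) (open_exp k u g)"
| "open_exp k u (CaseImp e f) = CaseImp (open_exp k u e) (open_exp k u f)"
| "open_exp k u (CaseAll e f) = CaseAll (open_exp k u e) (open_exp k u f)"
| "open_exp k u (CaseEx e f) = CaseEx (open_exp k u e) (open_exp k u f)"
| "open_exp k u (Rec r es) = Rec r (map (open_exp k u) es)"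
| "open_exp k u (IfEq d e f g) =
     IfEq (open_exp k u d) (open_exp k u e) (open_exp k u f) (open_exp k u g)"

primrec close_exp :: "nat \<Rightarrow> 'p \<Rightarrow> 'p exp \<Rightarrow> 'p exp" where
  "close_exp k p (Place q) = (if q = p then Idx k else Place q)"
| "close_exp k p (Idx i) = Idx i"
| "close_exp k p (Lam e) = Lam (close_exp (Suc k) p e)"
| "close_exp k p (App e f) = App (close_exp k p e) (close_exp k p f)"
| "close_exp k p (Dat d) = Dat d"
| "close_exp k p (EFn g es) = EFn g (map (close_exp k p) es)"
| "close_exp k p (EAnd e f) = EAnd (close_exp k p e) (close_exp k p f)"
| "close_exp k p (EOrL e) = EOrL (close_exp k p e)"
| "close_exp k p (EOrR e) = EOrR (close_exp k p e)"
| "close_exp k p (EImp e) = EImp (close_exp k p e)"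
| "close_exp k p (EAll e) = EAll (close_exp k p e)"
| "close_exp k p (EEx e f) = EEx (close_exp k p e) (close_exp k p f)"
| "close_exp k p (EBot e) = EBot (close_exp k p e)"
| "close_exp k p (CaseAnd e f) = CaseAnd (close_exp k p e) (close_exp k p f)"
| "close_exp k p (CaseOr e f g) = CaseOr (close_exp k p e) (close_exp k p f) (close_exp k p g)"
| "close_exp k p (CaseImp e f) = CaseImp (close_exp k p e) (close_exp k p f)"
| "close_exp k p (CaseAll e f) = CaseAll (close_exp k p e) (close_exp k p f)"
| "close_exp k p (CaseEx e f) = CaseEx (close_exp k p e) (close_exp k p f)"
| "close_exp k p (Rec r es) = Rec r (map (close_exp k p) es)"
| "close_exp k p (IfEq d e f g) =
     IfEq (close_exp k p d) (close_exp k p e) (close_exp k p f) (close_exp k p g)"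

primrec plug :: "('p \<Rightarrow> 'q exp) \<Rightarrow> 'p exp \<Rightarrow> 'q exp" where
  "plug \<theta> (Place p) = \<theta> p"
| "plug \<theta> (Idx i) = Idx i"
| "plug \<theta> (Lam e) = Lam (plug \<theta> e)"
| "plug \<theta> (App e f) = App (plug \<theta> e) (plug \<theta> f)"
| "plug \<theta> (Dat d) = Dat d"
| "plug \<theta> (EFn g es) = EFn g (map (plug \<theta>) es)"
| "plug \<theta> (EAnd e f) = EAnd (plug \<theta> e) (plug \<theta> f)"
| "plug \<theta> (EOrL e) = EOrL (plug \<theta> e)"
| "plug \<theta> (EOrR e) = EOrR (plug \<theta> e)"
| "plug \<theta> (EImp e) = EImp (plug \<theta> e)"
| "plug \<theta> (EAll e) = EAll (plug \<theta> e)"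
| "plug \<theta> (EEx e f) = EEx (plug \<theta> e) (plug \<theta> f)"
| "plug \<theta> (EBot e) = EBot (plug \<theta> e)"
| "plug \<theta> (CaseAnd e f) = CaseAnd (plug \<theta> e) (plug \<theta> f)"
| "plug \<theta> (CaseOr e f g) = CaseOr (plug \<theta> e) (plug \<theta> f) (plug \<theta> g)"
| "plug \<theta> (CaseImp e f) = CaseImp (plug \<theta> e) (plug \<theta> f)"
| "plug \<theta> (CaseAll e f) = CaseAll (plug \<theta> e) (plug \<theta> f)"
| "plug \<theta> (CaseEx e f) = CaseEx (plug \<theta> e) (plug \<theta> f)"
| "plug \<theta> (Rec r es) = Rec r (map (plug \<theta>) es)"
| "plug \<theta> (IfEq d e f g) = IfEq (plug \<theta> d) (plug \<theta> e) (plug \<theta> f) (plug \<theta> g)"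

definition apps :: "'p exp \<Rightarrow> 'p exp list \<Rightarrow> 'p exp" where
  "apps e es = foldl App e es"

definition lams :: "'p list \<Rightarrow> 'p exp \<Rightarrow> 'p exp" where
  "lams ps e = foldr (\<lambda>p f. Lam (close_exp 0 p f)) ps e"

text \<open>
  Computation of an expression to its outermost form.  The computing equations of the
  elimination operations are instances: with \<open>\<rightarrow>E(f, g)\<close> given by
  \<open>CaseImp f (Lam (App (Idx 0) g))\<close>, for example, \<open>\<rightarrow>E(\<rightarrow>I(h), g)\<close> computes as \<open>App h g\<close>.
  \<open>EBot\<close>, the operation \<open>\<bottom>\<^sub>\<alpha>\<close> from the empty set of grounds for \<open>\<bottom>\<close>, has no equation.
\<close>

inductive computes :: "'p exp \<Rightarrow> 'p exp \<Rightarrow> bool" where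
  "computes (Lam e) (Lam e)"
| "computes (Dat d) (Dat d)"
| "computes (EAnd e f) (EAnd e f)"
| "computes (EOrL e) (EOrL e)"
| "computes (EOrR e) (EOrR e)"
| "computes (EImp e) (EImp e)"
| "computes (EAll e) (EAll e)"
| "computes (EEx e f) (EEx e f)"
| "computes e (Lam b) \<Longrightarrow> computes (open_exp 0 f b) v \<Longrightarrow> computes (App e f) v"
| "list_all2 (\<lambda>e t. computes e (Dat (Ind t))) es ts \<Longrightarrow> computes (EFn g es) (Dat (Ind (Fn g ts)))"
| "computes e (EAnd a b) \<Longrightarrow> computes (App (App f a) b) v \<Longrightarrow> computes (CaseAnd e f) v"
| "computes e (EOrL a) \<Longrightarrow> computes (App f a) v \<Longrightarrow> computes (CaseOr e f g) v"
| "computes e (EOrR b) \<Longrightarrow> computes (App g b) v \<Longrightarrow> computes (CaseOr e f g) v"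
| "computes e (EImp h) \<Longrightarrow> computes (App f h) v \<Longrightarrow> computes (CaseImp e f) v"
| "computes e (EAll h) \<Longrightarrow> computes (App f h) v \<Longrightarrow> computes (CaseAll e f) v"
| "computes e (EEx a b) \<Longrightarrow> computes (App (App f a) b) v \<Longrightarrow> computes (CaseEx e f) v"
| "list_all2 (\<lambda>e d. computes e (Dat d)) es ds \<Longrightarrow> reval r (map code_datum ds) (code_datum d) \<Longrightarrow>
   computes (Rec r es) (Dat d)"
| "computes a (Dat d) \<Longrightarrow> computes b (Dat d) \<Longrightarrow> computes e v \<Longrightarrow> computes (IfEq a b e f) v"
| "computes a (Dat d) \<Longrightarrow> computes b (Dat d') \<Longrightarrow> d \<noteq> d' \<Longrightarrow> computes f v \<Longrightarrow>
   computes (IfEq a b e f) v"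


section \<open>Grounds and operations on grounds\<close>

text \<open>
  Places are of three kinds: individual arguments, ground arguments (named by typed variables
  \<open>\<xi>\<^sub>i\<^sup>\<alpha>\<close>, represented as \<open>(i, \<alpha>)\<close>), and the entries of the operation denoted by an operational symbol.
\<close>

type_synonym tvar = "nat \<times> fm"

abbreviation tvar_type :: "tvar \<Rightarrow> fm" where
  "tvar_type \<xi> \<equiv> snd \<xi>"

datatype plc = PInd nat | PGr tvar | PEntry nat

type_synonym ex = "plc exp"

text \<open>
  Grounds for closed formulas.  An expression is a ground if it computes to a canonical one;
  the ground is the object so presented.  The witness of \<open>\<exists>I\<close> and the side of \<open>\<or>I\<close>, which are
  given with the operational types \<open>\<alpha>(t) \<rhd> \<exists>x\<alpha>(x)\<close> and \<open>\<alpha>\<^sub>i \<rhd> \<alpha>\<^sub>1 \<or> \<alpha>\<^sub>2\<close> of these operations, are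
  recorded in the expression.
\<close>

function ground :: "base \<Rightarrow> fm \<Rightarrow> ex \<Rightarrow> bool" where
  "ground B Falsum e = False"
| "ground B (Atom p ts) e =
     (closed_exp e \<and> (\<exists>d. computes e (Dat (Der d)) \<and> closed_deriv B d \<and> concl d = Atom p ts))"
| "ground B (Conj a b) e =
     (closed_exp e \<and> (\<exists>e1 e2. computes e (EAnd e1 e2) \<and> ground B a e1 \<and> ground B b e2))"
| "ground B (Disj a b) e =
     (closed_exp e \<and> ((\<exists>e1. computes e (EOrL e1) \<and> ground B a e1) \<or>
                      (\<exists>e2. computes e (EOrR e2) \<and> ground B b e2)))"
| "ground B (Impl a b) e =
     (closed_exp e \<and> (\<exists>f. computes e (EImp f) \<and> (\<forall>g. ground B a g \<longrightarrow> ground B b (App f g))))"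
| "ground B (Forall a) e =
     (closed_exp e \<and> (\<exists>f. computes e (EAll f) \<and>
        (\<forall>t \<in> individuals B. ground B (inst a t) (App f (Dat (Ind t))))))"
| "ground B (Exists a) e =
     (closed_exp e \<and> (\<exists>w t g. computes e (EEx w g) \<and> computes w (Dat (Ind t)) \<and>
        t \<in> individuals B \<and> ground B (inst a t) g))"
  by pat_completeness auto
termination by (relation "measure (\<lambda>(B, a, e). degree a)") auto

text \<open>Equivalence of grounds for a closed formula.\<close>

function gequiv :: "base \<Rightarrow> fm \<Rightarrow> ex \<Rightarrow> ex \<Rightarrow> bool" where
  "gequiv B Falsum e e' = False"
| "gequiv B (Atom p ts) e e' = (\<exists>d. computes e (Dat (Der d)) \<and> computes e' (Dat (Der d)))"
| "gequiv B (Conj a b) e e' =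
     (\<exists>e1 e2 e1' e2'. computes e (EAnd e1 e2) \<and> computes e' (EAnd e1' e2') \<and>
        gequiv B a e1 e1' \<and> gequiv B b e2 e2')"
| "gequiv B (Disj a b) e e' =
     ((\<exists>e1 e1'. computes e (EOrL e1) \<and> computes e' (EOrL e1') \<and> gequiv B a e1 e1') \<or>
      (\<exists>e2 e2'. computes e (EOrR e2) \<and> computes e' (EOrR e2') \<and> gequiv B b e2 e2'))"
| "gequiv B (Impl a b) e e' =
     (\<exists>f f'. computes e (EImp f) \<and> computes e' (EImp f') \<and>
        (\<forall>g. ground B a g \<longrightarrow> gequiv B b (App f g) (App f' g)))"
| "gequiv B (Forall a) e e' =
     (\<exists>f f'. computes e (EAll f) \<and> computes e' (EAll f') \<and>
        (\<forall>t \<in> individuals B. gequiv B (inst a t) (App f (Dat (Ind t))) (App f' (Dat (Ind t)))))"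
| "gequiv B (Exists a) e e' =
     (\<exists>w g w' g' t. computes e (EEx w g) \<and> computes e' (EEx w' g') \<and>
        computes w (Dat (Ind t)) \<and> computes w' (Dat (Ind t)) \<and> gequiv B (inst a t) g g')"
  by pat_completeness auto
termination by (relation "measure (\<lambda>(B, a, e, e'). degree a)") auto

text \<open>
  An operation on grounds: its individual arguments, its ground arguments, its value type and
  the right-hand side of its defining equation.  Its operational type is
  \<open>\<alpha>\<^sub>1, \<dots>, \<alpha>\<^sub>n \<rhd> opn_type g\<close> with \<open>\<alpha>\<^sub>i\<close> the types of the ground arguments.
\<close>

record opn =
  ind_args :: "nat set"
  gr_args :: "tvar set"
  opn_type :: fm
  opn_rhs :: ex

definition type_vars :: "opn \<Rightarrow> nat set" where
  "type_vars g = fv (opn_type g) \<union> (\<Union>\<xi> \<in> gr_args g. fv (tvar_type \<xi>))"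

definition value_at :: "(nat \<Rightarrow> tm) \<Rightarrow> (tvar \<Rightarrow> ex) \<Rightarrow> ex \<Rightarrow> ex" where
  "value_at \<sigma> \<rho> =
     plug (\<lambda>p. case p of PInd x \<Rightarrow> Dat (Ind (\<sigma> x)) | PGr \<xi> \<Rightarrow> \<rho> \<xi> | PEntry i \<Rightarrow> Place (PEntry i))"

definition assignment :: "base \<Rightarrow> (nat \<Rightarrow> tm) \<Rightarrow> bool" where
  "assignment B \<sigma> \<longleftrightarrow> (\<forall>x. \<sigma> x \<in> individuals B)"

definition gr_assignment :: "base \<Rightarrow> (nat \<Rightarrow> tm) \<Rightarrow> tvar set \<Rightarrow> (tvar \<Rightarrow> ex) \<Rightarrow> bool" where
  "gr_assignment B \<sigma> X \<rho> \<longleftrightarrow> (\<forall>\<xi> \<in> X. ground B (subst \<sigma> (tvar_type \<xi>)) (\<rho> \<xi>))"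

text \<open>\<open>g\<close> is a ground for the assertion \<open>\<Gamma> \<turnstile> \<beta>\<close>; for \<open>\<Gamma> = []\<close> and closed \<open>\<beta>\<close> without individual
  arguments these are the grounds for \<open>\<beta>\<close>.\<close>

definition ground_for :: "base \<Rightarrow> fm list \<Rightarrow> fm \<Rightarrow> opn \<Rightarrow> bool" where
  "ground_for B \<Gamma> \<beta> g \<longleftrightarrow>
     formula (base_lang B) \<beta> \<and> (\<forall>\<alpha> \<in> set \<Gamma>. formula (base_lang B) \<alpha>) \<and>
     opn_type g = \<beta> \<and>
     (\<exists>\<xi>s. distinct \<xi>s \<and> map tvar_type \<xi>s = \<Gamma> \<and> gr_args g = set \<xi>s) \<and>
     finite (ind_args g) \<and> type_vars g \<subseteq> ind_args g \<and>
     lc 0 (opn_rhs g) \<and> places (opn_rhs g) \<subseteq> PInd ` ind_args g \<union> PGr ` gr_args g \<and>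
     (\<forall>\<sigma> \<rho>. assignment B \<sigma> \<and> gr_assignment B \<sigma> (gr_args g) \<rho> \<longrightarrow>
        ground B (subst \<sigma> \<beta>) (value_at \<sigma> \<rho> (opn_rhs g)))"

text \<open>
  The names of argument places are immaterial: two operations are compared along a
  matching of their individual and ground arguments that respects the operational type.
\<close>

definition matching :: "(nat \<Rightarrow> nat) \<Rightarrow> (tvar \<Rightarrow> tvar) \<Rightarrow> opn \<Rightarrow> opn \<Rightarrow> bool" where
  "matching \<iota> \<pi> g h \<longleftrightarrow>
     bij \<iota> \<and> bij \<pi> \<and> opn_type h = opn_type g \<and>
     ind_args h = \<iota> ` ind_args g \<and> (\<forall>x \<in> type_vars g. \<iota> x = x) \<and>
     gr_args h = \<pi> ` gr_args g \<and> (\<forall>\<xi> \<in> gr_args g. tvar_type (\<pi> \<xi>) = tvar_type \<xi>)"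

definition op_equiv :: "base \<Rightarrow> opn \<Rightarrow> opn \<Rightarrow> bool" where
  "op_equiv B g h \<longleftrightarrow>
     (\<exists>\<iota> \<pi>. matching \<iota> \<pi> g h \<and>
        (\<forall>\<sigma> \<rho>. assignment B \<sigma> \<and> gr_assignment B \<sigma> (gr_args h) \<rho> \<longrightarrow>
           gequiv B (subst \<sigma> (opn_type h))
             (value_at (\<sigma> \<circ> \<iota>) (\<rho> \<circ> \<pi>) (opn_rhs g)) (value_at \<sigma> \<rho> (opn_rhs h))))"

text \<open>Identity: the same computation instructions, that is, the same atomic derivation or the
  same operation, recursively applied to the same arguments.\<close>

definition op_ident :: "opn \<Rightarrow> opn \<Rightarrow> bool" where
  "op_ident g h \<longleftrightarrow>
     (\<exists>\<iota> \<pi>. matching \<iota> \<pi> g h \<and>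
        opn_rhs h =
          map_exp (\<lambda>p. case p of PInd x \<Rightarrow> PInd (\<iota> x) | PGr \<xi> \<Rightarrow> PGr (\<pi> \<xi>) | PEntry i \<Rightarrow> PEntry i)
            (opn_rhs g))"


section \<open>Operational types with bindings\<close>

text \<open>
  An entry \<open>\<Gamma> \<rhd> \<alpha>\<close> of an operational type, together with the individual variables bound on it.
  On an entry with \<open>\<Gamma> \<noteq> []\<close>, typed variables of types \<open>\<Gamma>\<close> are bound.
\<close>

record entry =
  ent_vars :: "nat list"
  ent_hyps :: "fm list"
  ent_type :: fm

record optype =
  typ_inds :: "nat set"
  typ_entries :: "entry list"
  typ_res :: fm

definition ent_fv :: "entry \<Rightarrow> nat set" where
  "ent_fv E = (\<Union>\<alpha> \<in> set (ent_hyps E). fv \<alpha>) \<union> fv (ent_type E) - set (ent_vars E)"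

text \<open>The individual arguments \<open>typ_inds\<close> include the free variables of the type.\<close>

definition wf_optype :: "language \<Rightarrow> optype \<Rightarrow> bool" where
  "wf_optype L \<tau> \<longleftrightarrow>
     finite (typ_inds \<tau>) \<and> formula L (typ_res \<tau>) \<and> fv (typ_res \<tau>) \<subseteq> typ_inds \<tau> \<and>
     (\<forall>E \<in> set (typ_entries \<tau>).
        distinct (ent_vars E) \<and> (\<forall>\<alpha> \<in> set (ent_hyps E). formula L \<alpha>) \<and> formula L (ent_type E) \<and>
        ent_fv E \<subseteq> typ_inds \<tau>)"

text \<open>The arguments of an operation on an entry at the individuals \<open>\<sigma>\<close>: first-level
  operations in the bound variables, and grounds if nothing is bound.\<close>

definition argument :: "base \<Rightarrow> (nat \<Rightarrow> tm) \<Rightarrow> entry \<Rightarrow> ex \<Rightarrow> bool" where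
  "argument B \<sigma> E f \<longleftrightarrow>
     closed_exp f \<and>
     (\<forall>\<sigma>' gs. assignment B \<sigma>' \<and> (\<forall>x. x \<notin> set (ent_vars E) \<longrightarrow> \<sigma>' x = \<sigma> x) \<and>
        list_all2 (\<lambda>\<alpha> g. ground B (subst \<sigma>' \<alpha>) g) (ent_hyps E) gs \<longrightarrow>
        ground B (subst \<sigma>' (ent_type E))
          (apps f (map (\<lambda>x. Dat (Ind (\<sigma>' x))) (ent_vars E) @ gs)))"

text \<open>\<open>p\<close> is the right-hand side of a defining equation of an operation on grounds of type \<open>\<tau>\<close>.\<close>

definition operation :: "base \<Rightarrow> optype \<Rightarrow> ex \<Rightarrow> bool" where
  "operation B \<tau> p \<longleftrightarrow>
     lc 0 p \<and>
     places p \<subseteq> PInd ` typ_inds \<tau> \<union> PEntry ` {..<length (typ_entries \<tau>)} \<and>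
     (\<forall>\<sigma> fs. assignment B \<sigma> \<and> list_all2 (argument B \<sigma>) (typ_entries \<tau>) fs \<longrightarrow>
        ground B (subst \<sigma> (typ_res \<tau>))
          (plug (\<lambda>q. case q of PInd x \<Rightarrow> Dat (Ind (\<sigma> x)) | PGr \<xi> \<Rightarrow> Place (PGr \<xi>)
                    | PEntry i \<Rightarrow> fs ! i) p))"


section \<open>Languages of grounding\<close>

text \<open>\<open>Lab i \<tau>\<close> is the non-primitive symbol \<open>F\<^sub>i[\<tau>]\<close>; \<open>SOrL\<close> and \<open>SOrR\<close> are the symbol \<open>\<or>I\<close> with
  its two operational types, and \<open>SAll x a\<close> is \<open>\<forall>I\<close> binding \<open>x\<close>.\<close>

datatype opsym =
    Lab nat optype
  | SAnd fm fm
  | SOrL fm fm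
  | SOrR fm fm
  | SImp fm fm
  | SAll nat fm
  | SEx fm tm
  | SBot fm

abbreviation plain :: "fm \<Rightarrow> entry" where
  "plain \<alpha> \<equiv> \<lparr>ent_vars = [], ent_hyps = [], ent_type = \<alpha>\<rparr>"

primrec sym_type :: "opsym \<Rightarrow> optype" where
  "sym_type (Lab i \<tau>) = \<tau>"
| "sym_type (SAnd a b) =
     \<lparr>typ_inds = fv a \<union> fv b, typ_entries = [plain a, plain b], typ_res = Conj a b\<rparr>"
| "sym_type (SOrL a b) =
     \<lparr>typ_inds = fv a \<union> fv b, typ_entries = [plain a], typ_res = Disj a b\<rparr>"
| "sym_type (SOrR a b) =
     \<lparr>typ_inds = fv a \<union> fv b, typ_entries = [plain b], typ_res = Disj a b\<rparr>"
| "sym_type (SImp a b) =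
     \<lparr>typ_inds = fv a \<union> fv b,
      typ_entries = [\<lparr>ent_vars = [], ent_hyps = [a], ent_type = b\<rparr>], typ_res = Impl a b\<rparr>"
| "sym_type (SAll x a) =
     \<lparr>typ_inds = fv a,
      typ_entries = [\<lparr>ent_vars = [x], ent_hyps = [], ent_type = inst a (Var x)\<rparr>],
      typ_res = Forall a\<rparr>"
| "sym_type (SEx a t) =
     \<lparr>typ_inds = fv a \<union> fv_tm t, typ_entries = [plain (inst a t)], typ_res = Exists a\<rparr>"
| "sym_type (SBot a) =
     \<lparr>typ_inds = fv a, typ_entries = [plain Falsum], typ_res = a\<rparr>"

primrec wf_sym :: "language \<Rightarrow> opsym \<Rightarrow> bool" where
  "wf_sym L (Lab i \<tau>) = wf_optype L \<tau>"
| "wf_sym L (SAnd a b) = (formula L a \<and> formula L b)"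
| "wf_sym L (SOrL a b) = (formula L a \<and> formula L b)"
| "wf_sym L (SOrR a b) = (formula L a \<and> formula L b)"
| "wf_sym L (SImp a b) = (formula L a \<and> formula L b)"
| "wf_sym L (SAll x a) = (formula L (Forall a) \<and> x \<notin> fv a)"
| "wf_sym L (SEx a t) = (formula L (Exists a) \<and> wf_tm L 0 t)"
| "wf_sym L (SBot a) = formula L a"

text \<open>A language of grounding is given by its set of operational symbols: the individual
  constants and the typed variables are determined by the base.\<close>

definition language_of_grounding :: "base \<Rightarrow> opsym set \<Rightarrow> bool" where
  "language_of_grounding B \<Lambda> \<longleftrightarrow>
     (\<forall>F \<in> \<Lambda>. wf_sym (base_lang B) F) \<and>
     (\<forall>i \<tau>. Lab i \<tau> \<in> \<Lambda> \<longrightarrow> (\<exists>p. operation B \<tau> p))"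

definition expansion :: "base \<Rightarrow> opsym set \<Rightarrow> opsym set \<Rightarrow> bool" where
  "expansion B \<Lambda>1 \<Lambda>2 \<longleftrightarrow> language_of_grounding B \<Lambda>2 \<and> \<Lambda>1 \<subseteq> \<Lambda>2"

text \<open>\<open>Cst d\<close> is the individual constant naming \<open>d\<close>.  In \<open>Ap F [\<xi>s\<^sub>1, \<dots>, \<xi>s\<^sub>n] [U\<^sub>1, \<dots>, U\<^sub>n]\<close> the list \<open>\<xi>s\<^sub>i\<close>
  consists of the typed variables bound by \<open>F\<close> on \<open>U\<^sub>i\<close>; the bound individual variables are
  given by the type of \<open>F\<close>.\<close>

datatype gterm = Cst deriv | TVar tvar | Ap opsym "tvar list list" "gterm list"

primrec term_type :: "gterm \<Rightarrow> fm" where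
  "term_type (Cst d) = concl d"
| "term_type (TVar \<xi>) = tvar_type \<xi>"
| "term_type (Ap F \<xi>ss Us) = typ_res (sym_type F)"

primrec free_tvars :: "gterm \<Rightarrow> tvar set" where
  "free_tvars (Cst d) = {}"
| "free_tvars (TVar \<xi>) = {\<xi>}"
| "free_tvars (Ap F \<xi>ss Us) = (\<Union>i<length Us. map free_tvars Us ! i - set (\<xi>ss ! i))"

primrec free_inds :: "gterm \<Rightarrow> nat set" where
  "free_inds (Cst d) = fv (concl d)"
| "free_inds (TVar \<xi>) = fv (tvar_type \<xi>)"
| "free_inds (Ap F \<xi>ss Us) =
     typ_inds (sym_type F) \<union>
     (\<Union>i<length Us. (map free_inds Us ! i \<union> (\<Union>\<xi> \<in> set (\<xi>ss ! i). fv (tvar_type \<xi>)))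
                      - set (ent_vars (typ_entries (sym_type F) ! i)))"

text \<open>
  Terms of a language of grounding.  Constants name the closed derivations of atomic formulas
  other than \<open>\<bottom>\<close>, as \<open>\<bottom>\<close> has no grounds.  An individual variable bound on \<open>U\<^sub>i\<close> must not be
  free in the type of a typed variable that remains free in \<open>U\<^sub>i\<close>.
\<close>

inductive is_term :: "base \<Rightarrow> opsym set \<Rightarrow> gterm \<Rightarrow> bool" for B \<Lambda> where
  "closed_deriv B d \<Longrightarrow> concl d \<noteq> Falsum \<Longrightarrow> is_term B \<Lambda> (Cst d)"
| "formula (base_lang B) (tvar_type \<xi>) \<Longrightarrow> is_term B \<Lambda> (TVar \<xi>)"
| "F \<in> \<Lambda> \<Longrightarrow> Es = typ_entries (sym_type F) \<Longrightarrow>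
   length \<xi>ss = length Es \<Longrightarrow> length Us = length Es \<Longrightarrow>
   \<forall>U \<in> set Us. is_term B \<Lambda> U \<Longrightarrow>
   \<forall>i < length Es.
     term_type (Us ! i) = ent_type (Es ! i) \<and>
     distinct (\<xi>ss ! i) \<and> map tvar_type (\<xi>ss ! i) = ent_hyps (Es ! i) \<and>
     (\<forall>\<xi> \<in> free_tvars (Us ! i) - set (\<xi>ss ! i). fv (tvar_type \<xi>) \<inter> set (ent_vars (Es ! i)) = {}) \<Longrightarrow>
   is_term B \<Lambda> (Ap F \<xi>ss Us)"

definition closed_term :: "gterm \<Rightarrow> bool" where
  "closed_term U \<longleftrightarrow> free_tvars U = {} \<and> free_inds U = {}"

primrec canonical :: "gterm \<Rightarrow> bool" where
  "canonical (Cst d) = True"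
| "canonical (TVar \<xi>) = True"
| "canonical (Ap F \<xi>ss Us) =
     (case F of Lab i \<tau> \<Rightarrow> False | SBot a \<Rightarrow> False | _ \<Rightarrow> True)"


section \<open>Denotation\<close>

primrec tm_exp :: "tm \<Rightarrow> ex" where
  "tm_exp (Var x) = Place (PInd x)"
| "tm_exp (Bnd i) = Dat (Ind (Bnd i))"
| "tm_exp (Fn f ts) = EFn f (map tm_exp ts)"

text \<open>The primitive operations; \<open>E\<^sub>i\<close> is the place of the \<open>i\<close>-th entry. (There is no
  primitive operation for \<open>Lab\<close>.)\<close>

fun primitive_op :: "opsym \<Rightarrow> ex option" where
  "primitive_op (Lab i \<tau>) = None"
| "primitive_op (SAnd a b) = Some (EAnd (Place (PEntry 0)) (Place (PEntry 1)))"
| "primitive_op (SOrL a b) = Some (EOrL (Place (PEntry 0)))"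
| "primitive_op (SOrR a b) = Some (EOrR (Place (PEntry 0)))"
| "primitive_op (SImp a b) = Some (EImp (Place (PEntry 0)))"
| "primitive_op (SAll x a) = Some (EAll (Place (PEntry 0)))"
| "primitive_op (SEx a t) = Some (EEx (tm_exp t) (Place (PEntry 0)))"
| "primitive_op (SBot a) = Some (EBot (Place (PEntry 0)))"

datatype letter = LCst deriv | LVar tvar | LSym opsym

text \<open>Denotations for the alphabet.  A typed variable denotes the identity operation, whose
  defining equation has the argument itself as right-hand side.\<close>

definition denotation :: "base \<Rightarrow> opsym set \<Rightarrow> (letter \<Rightarrow> ex) \<Rightarrow> bool" where
  "denotation B \<Lambda> \<delta> \<longleftrightarrow>
     (\<forall>d. closed_deriv B d \<and> concl d \<noteq> Falsum \<longrightarrow> \<delta> (LCst d) = Dat (Der d)) \<and>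
     (\<forall>\<xi>. formula (base_lang B) (tvar_type \<xi>) \<longrightarrow> \<delta> (LVar \<xi>) = Place (PGr \<xi>)) \<and>
     (\<forall>F \<in> \<Lambda>. case primitive_op F of
         Some p \<Rightarrow> \<delta> (LSym F) = p
       | None \<Rightarrow> operation B (sym_type F) (\<delta> (LSym F)))"

text \<open>
  The operation denoted by \<open>F\<close> is composed with those denoted by the immediate subterms, taken
  as first-level operations in the variables bound on them.
\<close>

primrec den_rhs :: "(letter \<Rightarrow> ex) \<Rightarrow> gterm \<Rightarrow> ex" where
  "den_rhs \<delta> (Cst d) = \<delta> (LCst d)"
| "den_rhs \<delta> (TVar \<xi>) = \<delta> (LVar \<xi>)"
| "den_rhs \<delta> (Ap F \<xi>ss Us) =
     plug (\<lambda>q. case q of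
         PInd x \<Rightarrow> Place (PInd x)
       | PGr \<xi> \<Rightarrow> Place (PGr \<xi>)
       | PEntry i \<Rightarrow>
           lams (map PInd (ent_vars (typ_entries (sym_type F) ! i)) @ map PGr (\<xi>ss ! i))
             (map (den_rhs \<delta>) Us ! i))
       (\<delta> (LSym F))"

definition den :: "(letter \<Rightarrow> ex) \<Rightarrow> gterm \<Rightarrow> opn" where
  "den \<delta> U =
     \<lparr>ind_args = free_inds U, gr_args = free_tvars U, opn_type = term_type U,
      opn_rhs = den_rhs \<delta> U\<rparr>"

definition closed_under_canonical_form ::
    "base \<Rightarrow> opsym set \<Rightarrow> (letter \<Rightarrow> ex) \<Rightarrow> gterm \<Rightarrow> bool" where
  "closed_under_canonical_form B \<Lambda> \<delta> T \<longleftrightarrow>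
     (\<exists>U. is_term B \<Lambda> U \<and> closed_term U \<and> canonical U \<and> op_equiv B (den \<delta> T) (den \<delta> U))"

definition principle_K :: "language \<Rightarrow> bool" where
  "principle_K L \<longleftrightarrow>
     (\<forall>B \<Gamma> \<beta> g. base_on L B \<and> ground_for B \<Gamma> \<beta> g \<longrightarrow>
        (\<exists>\<Lambda> \<delta> U. language_of_grounding B \<Lambda> \<and> denotation B \<Lambda> \<delta> \<and>
           is_term B \<Lambda> U \<and> term_type U = \<beta> \<and> op_ident (den \<delta> U) g))"

end

theory Submission
  imports Defs
begin

text \<open>
  By soundness of the denotation, a closed term \<open>T\<close> denotes a ground for its type \<open>\<alpha>\<close>, which
  computes to an outermost primitive operation applied to immediate components.  These components
  are themselves (first-level operations on) grounds, so each of them may be made the denotation of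
  a fresh label; the primitive symbol applied to the new labels is the required canonical term.
\<close>

section \<open>Substitution\<close>

text \<open>That a component can be denoted by a label is immediate here: grounds are themselves
  expressions, hence already right-hand sides of defining equations. The obstacle is \<rightarrow>I
  and \<forall>I, whose component f is a first-level operation, while the value of a label is always
  a ground. The label therefore takes as argument the variable which the primitive symbol then
  binds, and \<open>den_rhs\<close> yields the abstraction \<open>Lam (App f (Idx 0))\<close>
  instead of f. The two expressions differ but compute alike when applied. This, together with the
  evaluation of subterms under binders in the soundness proof, is the reason for the relation
  \<open>reduces\<close>, and the canonical term is reached up to equivalence. The identity of the
  two denotations of T, by contrast, is literal equality, because every label that receives a new
  denotation lies beyond all labels occurring in T.\<close>

lemma subst_tm_cong: "(\<And>x. x \<in> fv_tm t \<Longrightarrow> \<sigma> x = \<sigma>' x) \<Longrightarrow> subst_tm \<sigma> t = subst_tm \<sigma>' t"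
  by (induction t) auto

lemma subst_cong: "(\<And>x. x \<in> fv a \<Longrightarrow> \<sigma> x = \<sigma>' x) \<Longrightarrow> subst \<sigma> a = subst \<sigma>' a"
  by (induction a) (auto intro: subst_tm_cong)

lemma subst_tm_Var [simp]: "subst_tm Var t = t"
  by (induction t) (auto intro: map_idI)

lemma subst_Var [simp]: "subst Var a = a"
  by (induction a) (auto intro: map_idI)

lemma subst_closed: "fv a = {} \<Longrightarrow> subst \<sigma> a = a"
  using subst_cong[of a \<sigma> Var] by simp

lemma fv_subst_tm: "fv_tm (subst_tm \<sigma> t) = (\<Union>x \<in> fv_tm t. fv_tm (\<sigma> x))"
  by (induction t) auto

lemma fv_subst: "fv (subst \<sigma> a) = (\<Union>x \<in> fv a. fv_tm (\<sigma> x))"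
  by (induction a) (auto simp: fv_subst_tm)

lemma wf_subst_tm: "wf_tm L k t \<Longrightarrow> (\<And>x. wf_tm L k (\<sigma> x)) \<Longrightarrow> wf_tm L k (subst_tm \<sigma> t)"
  by (induction t) (auto simp: list_all_iff)

lemma wf_tm_mono: "wf_tm L k t \<Longrightarrow> k \<le> l \<Longrightarrow> wf_tm L l t"
  by (induction t) (auto simp: list_all_iff)

lemma wf_subst: "wf_fm L k a \<Longrightarrow> (\<And>x. wf_tm L 0 (\<sigma> x)) \<Longrightarrow> wf_fm L k (subst \<sigma> a)"
  by (induction a arbitrary: k) (auto simp: list_all_iff intro: wf_subst_tm wf_tm_mono)

lemma inst_tm_id: "wf_tm L k t \<Longrightarrow> k \<le> l \<Longrightarrow> inst_tm l u t = t"
  by (induction t) (auto simp: list_all_iff intro: map_idI)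

lemma wf_inst_tm: "wf_tm L (Suc k) t \<Longrightarrow> wf_tm L 0 u \<Longrightarrow> wf_tm L k (inst_tm k u t)"
  by (induction t) (auto simp: list_all_iff intro: wf_tm_mono)

lemma wf_inst_fm: "wf_fm L (Suc k) a \<Longrightarrow> wf_tm L 0 u \<Longrightarrow> wf_fm L k (inst_fm k u a)"
  by (induction a arbitrary: k) (auto simp: list_all_iff intro: wf_inst_tm)

lemma fv_inst_tm: "fv_tm (inst_tm k u t) \<subseteq> fv_tm t \<union> fv_tm u"
  by (induction t) auto

lemma fv_inst_fm: "fv (inst_fm k u a) \<subseteq> fv a \<union> fv_tm u"
  using fv_inst_tm by (induction a arbitrary: k) fastforce+

text \<open>The terms \<open>\<sigma> x\<close> have no loose indices, so instantiating index
  \<open>k\<close> passes over them unchanged.\<close>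

lemma subst_inst_tm:
  "(\<And>x. wf_tm L 0 (\<sigma> x)) \<Longrightarrow>
   subst_tm \<sigma> (inst_tm k u t) = inst_tm k (subst_tm \<sigma> u) (subst_tm \<sigma> t)"
  by (induction t) (auto simp: inst_tm_id[of L 0])

lemma subst_inst_fm:
  "(\<And>x. wf_tm L 0 (\<sigma> x)) \<Longrightarrow>
   subst \<sigma> (inst_fm k u a) = inst_fm k (subst_tm \<sigma> u) (subst \<sigma> a)"
  by (induction a arbitrary: k) (auto intro: subst_inst_tm)

lemma wf_assignment: "assignment B \<sigma> \<Longrightarrow> wf_tm (base_lang B) 0 (\<sigma> x)"
  by (simp add: assignment_def individuals_def)

lemma subst_inst:
  "assignment B \<sigma> \<Longrightarrow> subst \<sigma> (inst a u) = inst (subst \<sigma> a) (subst_tm \<sigma> u)"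
  by (rule subst_inst_fm[OF wf_assignment])

lemma fv_assignment: "assignment B \<sigma> \<Longrightarrow> fv_tm (\<sigma> x) = {}"
  by (simp add: assignment_def individuals_def)

lemma subst_tm_individual:
  "wf_tm (base_lang B) 0 t \<Longrightarrow> assignment B \<sigma> \<Longrightarrow> subst_tm \<sigma> t \<in> individuals B"
  by (simp add: individuals_def fv_subst_tm fv_assignment wf_assignment wf_subst_tm)

lemma ex_assignment: "base_on L B \<Longrightarrow> \<exists>\<sigma>. assignment B \<sigma>"
  by (auto simp: base_on_def assignment_def)

lemma assignment_upd: "assignment B \<sigma> \<Longrightarrow> t \<in> individuals B \<Longrightarrow> assignment B (\<sigma>(x := t))"
  by (simp add: assignment_def)

text \<open>The last rule applied is a schema instantiated by closed terms. \<open>Falsum\<close>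
  stays possible, since atomic rules may conclude it; individual constants exclude that
  case.\<close>

lemma concl_closed_deriv:
  assumes "base_on L B" "closed_deriv B d"
  shows "formula (base_lang B) (concl d) \<and> fv (concl d) = {} \<and>
    (concl d = Falsum \<or> (\<exists>p ts. concl d = Atom p ts))"
  using assms(2)
proof cases
  case (1 ps c \<sigma> ds)
  then have \<sigma>: "assignment B \<sigma>" by (simp add: assignment_def)
  have "c = Falsum \<or> (formula (base_lang B) c \<and> (\<exists>p ts. c = Atom p ts))"
    using assms(1) 1 by (fastforce simp: base_on_def atomic_formula_def)
  then show ?thesis
    using 1 wf_subst[of _ 0 c \<sigma>] wf_assignment[OF \<sigma>]
    by (auto simp: fv_subst fv_assignment[OF \<sigma>] fv_subst_tm)
qed


section \<open>Expressions\<close>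

lemma lc_mono: "lc k e \<Longrightarrow> k \<le> l \<Longrightarrow> lc l e"
  by (induction e arbitrary: k l) (auto simp: list_all_iff)

lemma lc_plug: "lc k e \<Longrightarrow> (\<And>p. p \<in> places e \<Longrightarrow> lc 0 (\<theta> p)) \<Longrightarrow> lc k (plug \<theta> e)"
  by (induction e arbitrary: k) (auto simp: list_all_iff intro: lc_mono, blast+)

lemma places_plug: "places (plug \<theta> e) = (\<Union>p \<in> places e. places (\<theta> p))"
  by (induction e) auto

lemma plug_cong: "(\<And>p. p \<in> places e \<Longrightarrow> \<theta> p = \<eta> p) \<Longrightarrow> plug \<theta> e = plug \<eta> e"
  by (induction e) auto

lemma plug_Place [simp]: "plug Place e = e"
  by (induction e) (auto intro: map_idI)

lemma plug_closed: "places e = {} \<Longrightarrow> plug \<theta> e = e"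
  using plug_cong[of e \<theta> Place] by simp

lemma plug_plug: "plug \<theta> (plug \<eta> e) = plug (\<lambda>p. plug \<theta> (\<eta> p)) e"
  by (induction e) auto

lemma lc_close_exp: "lc k e \<Longrightarrow> lc (Suc k) (close_exp k p e)"
  by (induction e arbitrary: k) (auto simp: list_all_iff)

lemma places_close_exp: "places (close_exp k p e) = places e - {p}"
  by (induction e arbitrary: k) auto

lemma close_exp_fresh: "p \<notin> places e \<Longrightarrow> close_exp k p e = e"
  by (induction e arbitrary: k) (auto intro: map_idI)

lemma open_exp_lc: "lc j e \<Longrightarrow> j \<le> k \<Longrightarrow> open_exp k u e = e"
  by (induction e arbitrary: j k) (auto simp: list_all_iff intro!: map_idI)

text \<open>This is beta contraction for an abstraction over the place \<open>p\<close>. As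
  \<open>e\<close> has only indices below \<open>k\<close>, the index opened stems from
  \<open>p\<close> alone, and the other fillings, being without loose indices, are
  untouched.\<close>

lemma open_plug_close:
  "lc k e \<Longrightarrow> \<forall>q \<in> places e - {p}. lc 0 (\<theta> q) \<Longrightarrow>
   open_exp k u (plug \<theta> (close_exp k p e)) = plug (\<theta>(p := u)) e"
  by (induction e arbitrary: k) (auto simp: list_all_iff open_exp_lc[of 0], blast+)

lemma lc_lams: "lc 0 e \<Longrightarrow> lc 0 (lams ps e)"
  by (induction ps) (auto simp: lams_def intro: lc_close_exp)

lemma places_lams: "places (lams ps e) = places e - set ps"
  by (induction ps) (auto simp: lams_def places_close_exp)

lemma places_apps: "places (apps e es) = places e \<union> \<Union> (places ` set es)"
  by (induction es arbitrary: e) (auto simp: apps_def)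

lemma lc_apps: "lc k (apps e es) \<longleftrightarrow> lc k e \<and> list_all (lc k) es"
  by (induction es arbitrary: e) (auto simp: apps_def)

lemma closed_apps: "closed_exp (apps e es) \<longleftrightarrow> closed_exp e \<and> list_all closed_exp es"
  by (auto simp: closed_exp_def lc_apps places_apps list_all_iff)

\<comment> \<open>Call-by-name reduction\<close>
inductive_simps computes_canonical [simp]:
  "computes (Lam e) v"
  "computes (Dat d) v"
  "computes (EAnd e f) v"
  "computes (EOrL e) v"
  "computes (EOrR e) v"
  "computes (EImp e) v"
  "computes (EAll e) v"
  "computes (EEx e f) v"

text \<open>Reduction is expressed through results only, because \<open>ground\<close> and
  \<open>gequiv\<close> inspect an expression only through what it computes to, apart from
  closedness.\<close>

definition reduces :: "'p exp \<Rightarrow> 'p exp \<Rightarrow> bool" where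
  "reduces e' e \<longleftrightarrow> (\<forall>v. computes e v \<longrightarrow> computes e' v)"

lemma reduces_refl: "reduces e e"
  by (simp add: reduces_def)

lemma reduces_trans: "reduces e f \<Longrightarrow> reduces f g \<Longrightarrow> reduces e g"
  by (simp add: reduces_def)

text \<open>Call by name evaluates the head first and passes the argument on unevaluated, so only
  the head matters.\<close>

lemma reduces_App:
  assumes "reduces e' e"
  shows "reduces (App e' f) (App e f)"
  unfolding reduces_def
proof (intro allI impI)
  fix v
  assume "computes (App e f) v"
  then show "computes (App e' f) v"
    using assms by cases (auto simp: reduces_def intro: computes.intros)
qed

lemma reduces_apps: "reduces e' e \<Longrightarrow> reduces (apps e' es) (apps e es)"
  by (induction es arbitrary: e e') (auto simp: apps_def intro: reduces_App)

lemma reduces_beta: "reduces (App (Lam b) u) (open_exp 0 u b)"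
  by (auto simp: reduces_def intro: computes.intros)

text \<open>Iterated beta contraction: each step moves one argument into the filling, hence the
  induction over arbitrary \<open>\<theta>\<close>. It links a subterm taken as a first-level
  operation with its value at a changed assignment.\<close>

lemma reduces_apps_lams:
  assumes "lc 0 e" "distinct ps" "length us = length ps"
    and "\<And>q. q \<in> places e - set ps \<Longrightarrow> lc 0 (\<theta> q)" "list_all (lc 0) us"
    and "\<And>i. i < length ps \<Longrightarrow> \<theta>' (ps ! i) = us ! i"
    and "\<And>q. q \<in> places e - set ps \<Longrightarrow> \<theta>' q = \<theta> q"
  shows "reduces (apps (plug \<theta> (lams ps e)) us) (plug \<theta>' e)"
  using assms
proof (induction ps arbitrary: us \<theta>)
  case Nil
  then have "plug \<theta> e = plug \<theta>' e" by (auto intro: plug_cong)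
  with Nil show ?case by (simp add: lams_def apps_def reduces_refl)
next
  case (Cons p ps)
  then obtain u us' where us: "us = u # us'" "length us' = length ps" by (cases us) auto
  let ?l = "lams ps e"
  have l: "lams (p # ps) e = Lam (close_exp 0 p ?l)" by (simp add: lams_def)
  have "open_exp 0 u (plug \<theta> (close_exp 0 p ?l)) = plug (\<theta>(p := u)) ?l"
    using Cons.prems by (intro open_plug_close) (auto simp: lc_lams places_lams)
  then have "reduces (App (plug \<theta> (lams (p # ps) e)) u) (plug (\<theta>(p := u)) ?l)"
    using reduces_beta[of "plug \<theta> (close_exp 0 p ?l)" u] by (simp add: l)
  then have "reduces (apps (plug \<theta> (lams (p # ps) e)) us) (apps (plug (\<theta>(p := u)) ?l) us')"
    using reduces_apps by (fastforce simp: us apps_def)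
  moreover have "reduces (apps (plug (\<theta>(p := u)) ?l) us') (plug \<theta>' e)"
  proof (rule Cons.IH)
    show "\<theta>' (ps ! i) = us' ! i" if "i < length ps" for i
      using Cons.prems(6)[of "Suc i"] that us by simp
    \<comment> \<open>Once its abstraction is removed, \<open>p\<close> itself may be among these
      places; there the update supplies \<open>u\<close>, which is
      \<open>\<theta>' p\<close>.\<close>
    show "\<theta>' q = (\<theta>(p := u)) q" if "q \<in> places e - set ps" for q
      using Cons.prems(6)[of 0] Cons.prems(7)[of q] that us by auto
  qed (use Cons.prems us in auto)
  ultimately show ?case by (rule reduces_trans)
qed


section \<open>Grounds\<close>

lemma closed_ground: "ground B a e \<Longrightarrow> closed_exp e"
  by (cases a) auto

text \<open>Every clause of \<open>ground\<close> sees \<open>e\<close> only through its closedness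
  and its canonical forms; \<open>reduces\<close> transports the latter but not the former.\<close>

lemma ground_reduces:
  "ground B a e \<Longrightarrow> reduces e' e \<Longrightarrow> closed_exp e' \<Longrightarrow> ground B a e'"
  by (cases a) (auto simp: reduces_def)

lemma gequiv_reduces:
  "gequiv B a e f \<Longrightarrow> reduces f' f \<Longrightarrow> gequiv B a e f'"
  by (cases a) (auto simp: reduces_def, blast+)

text \<open>Equivalence asks for canonical forms on both sides, so reflexivity is confined to
  grounds and follows the recursion of \<open>ground\<close>.\<close>

lemma gequiv_refl: "ground B a e \<Longrightarrow> gequiv B a e e"
  by (induction B a e rule: ground.induct) (auto, blast+)

text \<open>With nothing bound, \<open>\<sigma>'\<close> can only be \<open>\<sigma>\<close> and the
  list of supplied grounds is empty.\<close>

lemma argument_plain [simp]: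
  "argument B \<sigma> (plain a) f \<longleftrightarrow>
   closed_exp f \<and> (assignment B \<sigma> \<longrightarrow> ground B (subst \<sigma> a) f)"
  by (auto simp: argument_def apps_def fun_eq_iff[symmetric])

lemma computes_tm_exp:
  "wf_tm L 0 t \<Longrightarrow> (\<And>x. \<theta> (PInd x) = Dat (Ind (\<sigma> x))) \<Longrightarrow>
   computes (plug \<theta> (tm_exp t)) (Dat (Ind (subst_tm \<sigma> t)))"
proof (induction t)
  case (Fn f ts)
  then have "list_all2 (\<lambda>e t. computes e (Dat (Ind t)))
      (map (\<lambda>t. plug \<theta> (tm_exp t)) ts) (map (subst_tm \<sigma>) ts)"
    by (simp add: list_all2_conv_all_nth list_all_iff)
  then show ?case by (auto simp: comp_def intro: computes.intros)
qed (auto intro: computes.intros)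

lemma lc_tm_exp [simp]: "lc k (tm_exp t)"
  by (induction t) (auto simp: list_all_iff)

lemma places_tm_exp [simp]: "places (tm_exp t) = PInd ` fv_tm t"
  by (induction t) auto


section \<open>Terms denote grounds\<close>

text \<open>For the introductions this is the matching clause of \<open>ground\<close>, read at
  instantiated types. For \<open>SBot\<close> it is vacuous: no argument of type
  \<open>Falsum\<close> exists once an assignment is given.\<close>

lemma operation_primitive:
  assumes "wf_sym (base_lang B) F" "primitive_op F = Some p"
  shows "operation B (sym_type F) p"
proof (cases F)
  case (SAnd a b)
  then show ?thesis
    using assms by (auto simp: operation_def list_all2_Cons1 closed_exp_def)
next
  case (SOrL a b)
  then show ?thesis
    using assms by (auto simp: operation_def list_all2_Cons1 closed_exp_def)
next
  case (SOrR a b)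
  then show ?thesis
    using assms by (auto simp: operation_def list_all2_Cons1 closed_exp_def)
next
  case (SImp a b)
  have "ground B (subst \<sigma> (Impl a b)) (EImp f)"
    if \<sigma>: "assignment B \<sigma>" and f: "argument B \<sigma> \<lparr>ent_vars = [], ent_hyps = [a], ent_type = b\<rparr> f"
    for \<sigma> f
  proof -
    have "ground B (subst \<sigma> b) (App f g)" if "ground B (subst \<sigma> a) g" for g
      using f \<sigma> that unfolding argument_def apps_def
      by (auto dest!: spec[of _ \<sigma>] spec[of _ "[g]"])
    then show ?thesis
      using f by (auto simp: argument_def closed_exp_def)
  qed
  then show ?thesis
    using assms SImp by (auto simp: operation_def list_all2_Cons1)
next
  case (SAll x a)
  have "ground B (subst \<sigma> (Forall a)) (EAll f)"
    if \<sigma>: "assignment B \<sigma>"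
      and f: "argument B \<sigma> \<lparr>ent_vars = [x], ent_hyps = [], ent_type = inst a (Var x)\<rparr> f"
    for \<sigma> f
  proof -
    have "ground B (inst (subst \<sigma> a) t) (App f (Dat (Ind t)))" if t: "t \<in> individuals B" for t
    proof -
      let ?\<sigma> = "\<sigma>(x := t)"
      \<comment> \<open>The bound variable \<open>x\<close> is not free in \<open>a\<close>, so
        reassigning it affects only the instantiated position.\<close>
      have "subst ?\<sigma> a = subst \<sigma> a"
        using assms SAll by (auto intro: subst_cong)
      then have "subst ?\<sigma> (inst a (Var x)) = inst (subst \<sigma> a) t"
        using subst_inst[OF assignment_upd[OF \<sigma> t]] by simp
      then show ?thesis
        using f assignment_upd[OF \<sigma> t] unfolding argument_def apps_def
        by (auto dest!: spec[of _ ?\<sigma>])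
    qed
    then show ?thesis
      using f by (auto simp: argument_def closed_exp_def)
  qed
  then show ?thesis
    using assms SAll by (auto simp: operation_def list_all2_Cons1)
next
  case (SEx a t)
  have "ground B (subst \<sigma> (Exists a)) (EEx (plug \<theta> (tm_exp t)) f)"
    if \<sigma>: "assignment B \<sigma>" and f: "argument B \<sigma> (plain (inst a t)) f"
      and \<theta>: "\<And>x. \<theta> (PInd x) = Dat (Ind (\<sigma> x))" for \<sigma> f and \<theta> :: "plc \<Rightarrow> ex"
  proof -
    have "closed_exp (plug \<theta> (tm_exp t))"
      by (auto simp: closed_exp_def places_plug \<theta> intro!: lc_plug)
    moreover have "computes (plug \<theta> (tm_exp t)) (Dat (Ind (subst_tm \<sigma> t)))"
      using assms SEx \<theta> by (auto intro: computes_tm_exp)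
    moreover have "subst_tm \<sigma> t \<in> individuals B"
      using assms SEx \<sigma> by (auto intro: subst_tm_individual)
    moreover have "ground B (inst (subst \<sigma> a) (subst_tm \<sigma> t)) f"
      using f \<sigma> by (simp add: subst_inst)
    ultimately show ?thesis
      using f by (fastforce simp: closed_exp_def)
  qed
  then show ?thesis
    using assms SEx by (auto simp: operation_def list_all2_Cons1)
next
  case (SBot a)
  then show ?thesis
    using assms by (auto simp: operation_def list_all2_Cons1)
qed (use assms in simp)

lemma operation_denotation:
  assumes "language_of_grounding B \<Lambda>" "denotation B \<Lambda> \<delta>" "F \<in> \<Lambda>"
  shows "operation B (sym_type F) (\<delta> (LSym F))"
proof (cases "primitive_op F")
  case None
  then show ?thesis using assms by (force simp: denotation_def)
next
  case (Some p)
  then have "\<delta> (LSym F) = p" using assms by (force simp: denotation_def)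
  then show ?thesis
    using Some assms by (auto simp: language_of_grounding_def intro: operation_primitive)
qed

lemma distinct_ent_vars:
  "wf_sym L F \<Longrightarrow> E \<in> set (typ_entries (sym_type F)) \<Longrightarrow> distinct (ent_vars E)"
  by (cases F) (auto simp: wf_optype_def)

lemma fv_typ_res: "wf_sym L F \<Longrightarrow> fv (typ_res (sym_type F)) \<subseteq> typ_inds (sym_type F)"
  by (cases F) (auto simp: wf_optype_def)

lemma formula_typ_res: "wf_sym L F \<Longrightarrow> formula L (typ_res (sym_type F))"
  by (cases F) (auto simp: wf_optype_def)

lemma lc_den_rhs:
  assumes "language_of_grounding B \<Lambda>" "denotation B \<Lambda> \<delta>" "is_term B \<Lambda> U"
  shows "lc 0 (den_rhs \<delta> U)"
  using assms(3)
proof induction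
  case (3 F Es \<xi>ss Us)
  have "lc 0 (lams ps (den_rhs \<delta> U))" if "U \<in> set Us" for U ps
    using that 3 lc_lams by blast
  moreover have "operation B (sym_type F) (\<delta> (LSym F))"
    using assms 3 by (simp add: operation_denotation)
  ultimately show ?case
    using 3 by (auto simp: operation_def split: plc.split intro!: lc_plug)
qed (use assms in \<open>auto simp: denotation_def\<close>)

text \<open>\<open>lams\<close> removes exactly the places of the variables bound on a subterm, as
  \<open>free_inds\<close> and \<open>free_tvars\<close> do. For closed terms no place is
  left.\<close>

lemma places_den_rhs:
  assumes "language_of_grounding B \<Lambda>" "denotation B \<Lambda> \<delta>" "is_term B \<Lambda> U"
  shows "places (den_rhs \<delta> U) \<subseteq> PInd ` free_inds U \<union> PGr ` free_tvars U"
  using assms(3)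
proof induction
  case (3 F Es \<xi>ss Us)
  have op: "places (\<delta> (LSym F)) \<subseteq>
      PInd ` typ_inds (sym_type F) \<union> PEntry ` {..<length (typ_entries (sym_type F))}"
    using operation_denotation[OF assms(1,2)] 3 by (simp add: operation_def)
  have IH: "places (den_rhs \<delta> (Us ! i)) \<subseteq> PInd ` free_inds (Us ! i) \<union> PGr ` free_tvars (Us ! i)"
    if "i < length Us" for i
    using 3 that by simp
  show ?case
  proof
    fix r
    assume "r \<in> places (den_rhs \<delta> (Ap F \<xi>ss Us))"
    then obtain q where q: "q \<in> places (\<delta> (LSym F))" and
      r: "r \<in> places (case q of PInd x \<Rightarrow> Place (PInd x) | PGr \<xi> \<Rightarrow> Place (PGr \<xi>)
         | PEntry i \<Rightarrow>
             lams (map PInd (ent_vars (typ_entries (sym_type F) ! i)) @ map PGr (\<xi>ss ! i))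
               (map (den_rhs \<delta>) Us ! i))"
      by (auto simp: places_plug)
    show "r \<in> PInd ` free_inds (Ap F \<xi>ss Us) \<union> PGr ` free_tvars (Ap F \<xi>ss Us)"
    proof (cases q)
      case (PEntry i)
      then have i: "i < length Us" using q op 3 by auto
      have r': "r \<in> places (den_rhs \<delta> (Us ! i))"
        "r \<notin> PInd ` set (ent_vars (typ_entries (sym_type F) ! i))" "r \<notin> PGr ` set (\<xi>ss ! i)"
        using r i PEntry by (auto simp: places_lams)
      then consider x where "r = PInd x" "x \<in> free_inds (Us ! i)"
        | \<xi> where "r = PGr \<xi>" "\<xi> \<in> free_tvars (Us ! i)"
        using IH[OF i] by blast
      then show ?thesis
      proof cases
        case 1
        then have "x \<in> free_inds (Ap F \<xi>ss Us)" using r' i by force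
        with 1 show ?thesis by blast
      next
        case 2
        then have "\<xi> \<in> free_tvars (Ap F \<xi>ss Us)" using r' i by force
        with 2 show ?thesis by blast
      qed
    qed (use q r op in auto)
  qed
qed (use assms in \<open>auto simp: denotation_def\<close>)

text \<open>Soundness, for all assignments at once: under a binding symbol a subterm has to yield
  grounds at every reassignment of the bound variables. Beta expansion carries these grounds back to
  the applied abstraction.\<close>

lemma ground_den_rhs:
  assumes "base_on L B" "language_of_grounding B \<Lambda>" "denotation B \<Lambda> \<delta>" "is_term B \<Lambda> U"
    and "assignment B \<sigma>" "\<And>\<xi>. closed_exp (\<rho> \<xi>)" "gr_assignment B \<sigma> (free_tvars U) \<rho>"
  shows "ground B (subst \<sigma> (term_type U)) (value_at \<sigma> \<rho> (den_rhs \<delta> U))"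
  using assms(4-)
proof (induction U arbitrary: \<sigma> \<rho>)
  case (1 d)
  have d: "fv (concl d) = {}" "\<exists>p ts. concl d = Atom p ts"
    using concl_closed_deriv[OF assms(1) 1(1)] 1(2) by auto
  have "\<delta> (LCst d) = Dat (Der d)" using assms(3) 1 by (simp add: denotation_def)
  then show ?case
    using d 1 by (auto simp: subst_closed value_at_def closed_exp_def)
next
  case (2 \<xi>)
  then show ?case
    using assms(3) by (cases \<xi>) (simp add: denotation_def gr_assignment_def value_at_def)
next
  case (3 F Es \<xi>ss Us)
  have F: "wf_sym (base_lang B) F"
    using assms(2) 3 by (auto simp: language_of_grounding_def)
  have op: "operation B (sym_type F) (\<delta> (LSym F))"
    using operation_denotation[OF assms(2,3)] 3 by simp
  define ps where "ps i = map PInd (ent_vars (Es ! i)) @ map PGr (\<xi>ss ! i)" for i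
  define f where "f i = value_at \<sigma> \<rho> (lams (ps i) (den_rhs \<delta> (Us ! i)))" for i
  let ?\<theta> = "\<lambda>\<sigma> \<rho>. \<lambda>p. case p of PInd x \<Rightarrow> Dat (Ind (\<sigma> x)) | PGr \<xi> \<Rightarrow> \<rho> \<xi>
    | PEntry i \<Rightarrow> Place (PEntry i)"
  have lc_\<theta>: "lc 0 (?\<theta> \<sigma> \<rho> q)" for q
    using 3(8) by (auto simp: closed_exp_def split: plc.split)
  have arg: "argument B \<sigma> (Es ! i) (f i)" if i: "i < length Es" for i
    unfolding argument_def
  proof (intro conjI allI impI)
    let ?U = "Us ! i" and ?E = "Es ! i"
    have U: "is_term B \<Lambda> ?U" using 3 i by simp
    note lc = lc_den_rhs[OF assms(2,3) U] and pl = places_den_rhs[OF assms(2,3) U]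
    have pl_\<theta>: "places (?\<theta> \<sigma> \<rho> q) = {}" if "q \<in> places (den_rhs \<delta> ?U)" for q
      using pl that 3(8) by (auto simp: closed_exp_def)
    show closed: "closed_exp (f i)"
      using lc_lams[OF lc] lc_\<theta> pl_\<theta>
      by (auto simp: f_def value_at_def closed_exp_def places_plug places_lams intro!: lc_plug)
    fix \<sigma>' gs
    assume *: "assignment B \<sigma>' \<and> (\<forall>x. x \<notin> set (ent_vars ?E) \<longrightarrow> \<sigma>' x = \<sigma> x) \<and>
      list_all2 (\<lambda>\<alpha> g. ground B (subst \<sigma>' \<alpha>) g) (ent_hyps ?E) gs"
    have dist: "distinct (\<xi>ss ! i)" and hyps: "map tvar_type (\<xi>ss ! i) = ent_hyps ?E"
      and type: "term_type ?U = ent_type ?E"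
      and fresh: "\<forall>\<xi> \<in> free_tvars ?U - set (\<xi>ss ! i). fv (tvar_type \<xi>) \<inter> set (ent_vars ?E) = {}"
      using 3(5) i by auto
    have len: "length gs = length (\<xi>ss ! i)"
      using * hyps by (metis length_map list_all2_lengthD)
    have gs: "ground B (subst \<sigma>' (tvar_type (\<xi>ss ! i ! j))) (gs ! j)" if "j < length gs" for j
      using * that len by (auto simp: hyps[symmetric] list_all2_conv_all_nth)
    \<comment> \<open>The typed variables bound on the i-th subterm receive the supplied grounds;
      all others keep their value under \<open>\<rho>\<close>.\<close>
    define \<rho>' where "\<rho>' \<xi> = (case map_of (zip (\<xi>ss ! i) gs) \<xi> of Some g \<Rightarrow> g | None \<Rightarrow> \<rho> \<xi>)" for \<xi>
    have \<rho>'_nth: "\<rho>' (\<xi>ss ! i ! j) = gs ! j" if "j < length gs" for j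
      using that len dist by (simp add: \<rho>'_def map_of_zip_nth)
    have \<rho>'_out: "\<rho>' \<xi> = \<rho> \<xi>" if "\<xi> \<notin> set (\<xi>ss ! i)" for \<xi>
      using that len by (auto simp: \<rho>'_def split: option.split dest!: map_of_SomeD set_zip_leftD)
    have \<rho>'_closed: "closed_exp (\<rho>' \<xi>)" for \<xi>
    proof (cases "\<xi> \<in> set (\<xi>ss ! i)")
      case True
      then obtain j where "j < length gs" "\<xi> = \<xi>ss ! i ! j"
        using len by (auto simp: in_set_conv_nth)
      then show ?thesis using \<rho>'_nth closed_ground[OF gs] by simp
    qed (simp add: \<rho>'_out 3(8))
    have "gr_assignment B \<sigma>' (free_tvars ?U) \<rho>'"
      unfolding gr_assignment_def
    proof
      fix \<xi>
      assume \<xi>: "\<xi> \<in> free_tvars ?U"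
      show "ground B (subst \<sigma>' (tvar_type \<xi>)) (\<rho>' \<xi>)"
      proof (cases "\<xi> \<in> set (\<xi>ss ! i)")
        case True
        then show ?thesis using gs \<rho>'_nth len by (auto simp: in_set_conv_nth)
      next
        case False
        \<comment> \<open>Here the variable condition on terms enters: the type of a variable that
          stays free contains no individual variable bound on this entry.\<close>
        then have "subst \<sigma>' (tvar_type \<xi>) = subst \<sigma> (tvar_type \<xi>)"
          using \<xi> fresh * by (intro subst_cong) auto
        moreover have "\<xi> \<in> free_tvars (Ap F \<xi>ss Us)"
          using \<xi> False i 3(4) by auto
        moreover have "\<rho>' \<xi> = \<rho> \<xi>"
          using False by (rule \<rho>'_out)
        ultimately show ?thesis
          using 3(9) unfolding gr_assignment_def by metis
      qed
    qed
    then have "ground B (subst \<sigma>' (ent_type ?E)) (value_at \<sigma>' \<rho>' (den_rhs \<delta> ?U))"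
      using 3(6) i 3(4) * \<rho>'_closed type nth_mem[of i Us] by metis
    moreover
    let ?us = "map (\<lambda>x. Dat (Ind (\<sigma>' x))) (ent_vars ?E) @ gs"
    have gs_closed: "list_all closed_exp gs"
      using gs closed_ground by (metis list_all_length)
    have "reduces (apps (f i) ?us) (value_at \<sigma>' \<rho>' (den_rhs \<delta> ?U))"
      unfolding f_def value_at_def
    proof (rule reduces_apps_lams[OF lc _ _ lc_\<theta>])
      show "distinct (ps i)"
        using dist distinct_ent_vars[OF F] 3(2) i by (auto simp: ps_def distinct_map inj_on_def)
      show "length ?us = length (ps i)" by (simp add: ps_def len)
      show "list_all (lc 0) ?us" using gs_closed by (auto simp: list_all_iff closed_exp_def)
      show "?\<theta> \<sigma>' \<rho>' (ps i ! j) = ?us ! j" if "j < length (ps i)" for j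
        using that len by (auto simp: ps_def nth_append \<rho>'_nth)
      show "?\<theta> \<sigma>' \<rho>' q = ?\<theta> \<sigma> \<rho> q" if "q \<in> places (den_rhs \<delta> ?U) - set (ps i)" for q
        using that * \<rho>'_out by (auto simp: ps_def split: plc.split)
    qed
    moreover have "closed_exp (apps (f i) ?us)"
      unfolding closed_apps using closed gs_closed by (auto simp: list_all_iff closed_exp_def)
    ultimately show "ground B (subst \<sigma>' (ent_type ?E)) (apps (f i) ?us)"
      using ground_reduces by blast
  qed
  let ?fs = "map f [0..<length Es]"
  have "list_all2 (argument B \<sigma>) (typ_entries (sym_type F)) ?fs"
    using arg 3(2) by (auto simp: list_all2_conv_all_nth)
  then have "ground B (subst \<sigma> (typ_res (sym_type F)))
      (plug (\<lambda>q. case q of PInd x \<Rightarrow> Dat (Ind (\<sigma> x)) | PGr \<xi> \<Rightarrow> Place (PGr \<xi>)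
          | PEntry i \<Rightarrow> ?fs ! i) (\<delta> (LSym F)))"
    using op 3(7) by (auto simp: operation_def)
  also have "plug (\<lambda>q. case q of PInd x \<Rightarrow> Dat (Ind (\<sigma> x)) | PGr \<xi> \<Rightarrow> Place (PGr \<xi>)
          | PEntry i \<Rightarrow> ?fs ! i) (\<delta> (LSym F)) = value_at \<sigma> \<rho> (den_rhs \<delta> (Ap F \<xi>ss Us))"
    unfolding value_at_def den_rhs.simps plug_plug
  \<comment> \<open>The fillings need to agree only on places of the operation of F, which are
    individual arguments and entries. Typed variables come in only through the entries.\<close>
  proof (rule plug_cong)
    fix q
    assume "q \<in> places (\<delta> (LSym F))"
    then have "q \<in> PInd ` typ_inds (sym_type F) \<union> PEntry ` {..<length Es}"
      using op 3(2) by (auto simp: operation_def)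
    then show "(case q of PInd x \<Rightarrow> Dat (Ind (\<sigma> x)) | PGr \<xi> \<Rightarrow> Place (PGr \<xi>)
          | PEntry i \<Rightarrow> ?fs ! i) =
        plug (?\<theta> \<sigma> \<rho>) (case q of PInd x \<Rightarrow> Place (PInd x) | PGr \<xi> \<Rightarrow> Place (PGr \<xi>)
         | PEntry i \<Rightarrow>
             lams (map PInd (ent_vars (typ_entries (sym_type F) ! i)) @ map PGr (\<xi>ss ! i))
               (map (den_rhs \<delta>) Us ! i))"
      using 3(2,4) by (auto simp: f_def ps_def value_at_def)
  qed
  finally show ?case by simp
qed

lemma fv_term_type:
  assumes "language_of_grounding B \<Lambda>" "is_term B \<Lambda> U"
  shows "fv (term_type U) \<subseteq> free_inds U"
  using assms(2)
proof cases
  case (3 F Es \<xi>ss Us)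
  then show ?thesis
    using assms(1) fv_typ_res[of _ F] by (fastforce simp: language_of_grounding_def)
qed auto

lemma formula_term_type:
  assumes "base_on L B" "language_of_grounding B \<Lambda>" "is_term B \<Lambda> U"
  shows "formula (base_lang B) (term_type U)"
  using assms(3)
proof cases
  case (3 F Es \<xi>ss Us)
  then show ?thesis
    using assms(2) formula_typ_res[of _ F] by (auto simp: language_of_grounding_def)
qed (use assms(1) concl_closed_deriv in auto)

text \<open>All assignments give a closed term the same value, and one exists because the domain is
  inhabited.\<close>

lemma ground_closed_term:
  assumes "base_on L B" "language_of_grounding B \<Lambda>" "denotation B \<Lambda> \<delta>" "is_term B \<Lambda> U"
    and "closed_term U"
  shows "ground B (term_type U) (den_rhs \<delta> U)"
proof -
  obtain \<sigma> where \<sigma>: "assignment B \<sigma>" using ex_assignment[OF assms(1)] by blast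
  \<comment> \<open>Any closed expression would serve: no free typed variable imposes a type on
    it.\<close>
  let ?\<rho> = "\<lambda>\<xi> :: tvar. Lam (Idx 0) :: ex"
  have "ground B (subst \<sigma> (term_type U)) (value_at \<sigma> ?\<rho> (den_rhs \<delta> U))"
    using assms(5)
    by (intro ground_den_rhs[OF assms(1-4) \<sigma>])
      (auto simp: closed_exp_def gr_assignment_def closed_term_def)
  moreover have "subst \<sigma> (term_type U) = term_type U"
    using assms(5) fv_term_type[OF assms(2,4)] by (intro subst_closed) (auto simp: closed_term_def)
  moreover have "value_at \<sigma> ?\<rho> (den_rhs \<delta> U) = den_rhs \<delta> U"
    using assms(5) places_den_rhs[OF assms(2-4)]
    unfolding value_at_def by (intro plug_closed) (auto simp: closed_term_def)
  ultimately show ?thesis by simp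
qed

text \<open>Without arguments the identity matching suffices, and each value is the right-hand side
  itself.\<close>

lemma op_equiv_closed_terms:
  assumes "fv (term_type T) = {}" "closed_term T" "closed_term U" "term_type U = term_type T"
    and "places (den_rhs \<delta> T) = {}" "places (den_rhs \<delta> U) = {}"
    and "gequiv B (term_type T) (den_rhs \<delta> T) (den_rhs \<delta> U)"
  shows "op_equiv B (den \<delta> T) (den \<delta> U)"
proof -
  have "matching id id (den \<delta> T) (den \<delta> U)"
    using assms by (simp add: matching_def den_def closed_term_def)
  then show ?thesis
    unfolding op_equiv_def
    by (rule_tac exI[of _ id], rule_tac exI[of _ id])
      (use assms in \<open>simp add: den_def subst_closed value_at_def plug_closed\<close>)
qed

lemma op_ident_refl: "op_ident g g"
proof -
  have "case_plc PInd PGr PEntry = id"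
    by (auto simp: fun_eq_iff split: plc.split)
  then show ?thesis
    unfolding op_ident_def matching_def
    by (rule_tac exI[of _ id], rule_tac exI[of _ id]) (simp add: exp.map_id)
qed


section \<open>Adding labels\<close>

text \<open>All well-formed primitive symbols are added, since \<open>\<Lambda>\<close> may lack the
  introduction symbol that the canonical term starts with.\<close>

definition ext_syms :: "base \<Rightarrow> opsym set \<Rightarrow> (opsym \<rightharpoonup> ex) \<Rightarrow> opsym set" where
  "ext_syms B \<Lambda> \<nu> = \<Lambda> \<union> {F. wf_sym (base_lang B) F \<and> primitive_op F \<noteq> None} \<union> dom \<nu>"

text \<open>Primitive symbols come first because \<open>\<delta>\<close> is unconstrained on those
  outside \<open>\<Lambda>\<close>. Then \<open>\<nu>\<close> overrides \<open>\<delta>\<close>,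
  even on a label that already belongs to \<open>\<Lambda>\<close>.\<close>

definition ext_den :: "(letter \<Rightarrow> ex) \<Rightarrow> (opsym \<rightharpoonup> ex) \<Rightarrow> letter \<Rightarrow> ex" where
  "ext_den \<delta> \<nu> l = (case l of
     LSym F \<Rightarrow> (case primitive_op F of Some p \<Rightarrow> p
       | None \<Rightarrow> (case \<nu> F of Some p \<Rightarrow> p | None \<Rightarrow> \<delta> l))
   | _ \<Rightarrow> \<delta> l)"

definition new_labels :: "base \<Rightarrow> nat \<Rightarrow> (opsym \<rightharpoonup> ex) \<Rightarrow> bool" where
  "new_labels B k \<nu> \<longleftrightarrow> (\<forall>F p. \<nu> F = Some p \<longrightarrow>
     (\<exists>i \<tau>. F = Lab i \<tau> \<and> k \<le> i \<and> wf_optype (base_lang B) \<tau> \<and> operation B \<tau> p))"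

lemma expansion_ext_syms:
  assumes "language_of_grounding B \<Lambda>" "new_labels B k \<nu>"
  shows "expansion B \<Lambda> (ext_syms B \<Lambda> \<nu>)"
  using assms
  by (fastforce simp: expansion_def language_of_grounding_def ext_syms_def new_labels_def)

lemma denotation_ext_den:
  assumes "denotation B \<Lambda> \<delta>" "new_labels B k \<nu>"
  shows "denotation B (ext_syms B \<Lambda> \<nu>) (ext_den \<delta> \<nu>)"
  unfolding denotation_def
proof (intro conjI ballI)
  fix F
  assume F: "F \<in> ext_syms B \<Lambda> \<nu>"
  show "case primitive_op F of Some p \<Rightarrow> ext_den \<delta> \<nu> (LSym F) = p
    | None \<Rightarrow> operation B (sym_type F) (ext_den \<delta> \<nu> (LSym F))"
  proof (cases "primitive_op F")
    case None
    show ?thesis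
    proof (cases "\<nu> F")
      case (Some p)
      then show ?thesis
        using assms(2) None by (fastforce simp: ext_den_def new_labels_def)
    next
      case \<nu>: None
      then have "F \<in> \<Lambda>" using F None by (auto simp: ext_syms_def)
      then show ?thesis
        using assms(1) None \<nu> by (force simp: ext_den_def denotation_def)
    qed
  qed (simp add: ext_den_def)
qed (use assms(1) in \<open>auto simp: denotation_def ext_den_def\<close>)

text \<open>A term contains only finitely many labels, so all sufficiently large ones may be given a new
  denotation.  This is needed even though \<open>\<Lambda>\<close> is only to be extended: \<open>\<Lambda>\<close> may already contain every
  label of a given type.\<close>

lemma den_rhs_large_labels:
  assumes "is_term B \<Lambda> U"
  shows "\<exists>k. \<forall>\<delta> \<delta>'.
    (\<forall>l. (\<forall>F. l = LSym F \<longrightarrow> F \<in> \<Lambda> \<and> (\<forall>i \<tau>. F = Lab i \<tau> \<longrightarrow> i < k)) \<longrightarrow> \<delta> l = \<delta>' l) \<longrightarrow>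
    den_rhs \<delta> U = den_rhs \<delta>' U"
  using assms
proof induction
  case (3 F Es \<xi>ss Us)
  let ?agree = "\<lambda>k \<delta> \<delta>'. \<forall>l. (\<forall>F. l = LSym F \<longrightarrow> F \<in> \<Lambda> \<and> (\<forall>i \<tau>. F = Lab i \<tau> \<longrightarrow> i < k)) \<longrightarrow>
    \<delta> l = (\<delta>' l :: ex)"
  obtain m where m: "\<And>U \<delta> \<delta>'. U \<in> set Us \<Longrightarrow> ?agree (m U) \<delta> \<delta>' \<Longrightarrow> den_rhs \<delta> U = den_rhs \<delta>' U"
    using 3(6) by metis
  obtain j where j: "\<And>i \<tau>. F = Lab i \<tau> \<Longrightarrow> i < j"
    by (cases F) auto
  \<comment> \<open>The bound \<open>j\<close> covers the label F itself, and also keeps the set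
    nonempty when there are no subterms.\<close>
  define k where "k = Max (insert j (m ` set Us))"
  have k: "j \<le> k" "\<And>U. U \<in> set Us \<Longrightarrow> m U \<le> k"
    by (auto simp: k_def)
  have "den_rhs \<delta> (Ap F \<xi>ss Us) = den_rhs \<delta>' (Ap F \<xi>ss Us)" if "?agree k \<delta> \<delta>'" for \<delta> \<delta>'
  proof -
    have "?agree (m U) \<delta> \<delta>'" if "U \<in> set Us" for U
      using \<open>?agree k \<delta> \<delta>'\<close> k(2)[OF that] by (meson less_le_trans)
    then have "map (den_rhs \<delta>) Us = map (den_rhs \<delta>') Us"
      using m by auto
    moreover have "\<delta> (LSym F) = \<delta>' (LSym F)"
      using that 3(1) j k(1) by fastforce
    ultimately show ?thesis by (simp only: den_rhs.simps)
  qed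
  then show ?case by blast
qed auto

text \<open>On labels of \<open>\<Lambda>\<close> below \<open>k\<close> nothing is overridden, and
  on primitive symbols of \<open>\<Lambda>\<close> both denotations are forced. The bound is uniform
  in \<open>\<nu>\<close>, so it can be fixed before the new labels are chosen.\<close>

lemma den_rhs_ext_den:
  assumes "denotation B \<Lambda> \<delta>" "is_term B \<Lambda> U"
  obtains k where "\<And>\<nu>. new_labels B k \<nu> \<Longrightarrow> den_rhs (ext_den \<delta> \<nu>) U = den_rhs \<delta> U"
proof -
  obtain k where k: "\<And>\<delta> \<delta>'.
    (\<And>l. (\<forall>F. l = LSym F \<longrightarrow> F \<in> \<Lambda> \<and> (\<forall>i \<tau>. F = Lab i \<tau> \<longrightarrow> i < k)) \<Longrightarrow> \<delta> l = \<delta>' l) \<Longrightarrow>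
    den_rhs \<delta> U = den_rhs \<delta>' U"
    using den_rhs_large_labels[OF assms(2)] by metis
  have "den_rhs (ext_den \<delta> \<nu>) U = den_rhs \<delta> U" if \<nu>: "new_labels B k \<nu>" for \<nu>
  proof (rule k)
    fix l
    assume l: "\<forall>F. l = LSym F \<longrightarrow> F \<in> \<Lambda> \<and> (\<forall>i \<tau>. F = Lab i \<tau> \<longrightarrow> i < k)"
    show "ext_den \<delta> \<nu> l = \<delta> l"
    proof (cases l)
      case (LSym F)
      then have F: "F \<in> \<Lambda>" "\<And>i \<tau>. F = Lab i \<tau> \<Longrightarrow> i < k" using l by auto
      have "\<nu> F = None"
        using \<nu> F(2) by (cases "\<nu> F") (auto simp: new_labels_def, fastforce)
      then show ?thesis
        using assms(1) F(1) LSym by (force simp: ext_den_def denotation_def split: option.split)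
    qed (simp_all add: ext_den_def)
  qed
  then show thesis by (rule that)
qed


section \<open>Canonical terms for grounds\<close>

definition const_type :: "fm \<Rightarrow> optype" where
  "const_type a = \<lparr>typ_inds = {}, typ_entries = [], typ_res = a\<rparr>"

lemma wf_const_type: "formula L a \<Longrightarrow> fv a = {} \<Longrightarrow> wf_optype L (const_type a)"
  by (simp add: wf_optype_def const_type_def)

lemma operation_const_type: "ground B a e \<Longrightarrow> fv a = {} \<Longrightarrow> operation B (const_type a) e"
  using closed_ground[of B a e]
  by (simp add: operation_def const_type_def closed_exp_def plug_closed subst_closed)

text \<open>\<open>f\<close> itself may fail to be closed if \<open>a\<close> has no grounds.\<close>

lemma closed_operation_of_ground_Impl:
  assumes "\<forall>g. ground B a g \<longrightarrow> ground B b (App f g)"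
  obtains f' where "closed_exp f'"
    and "\<And>g. ground B a g \<Longrightarrow> ground B b (App f' g) \<and> gequiv B b (App f g) (App f' g)"
proof (cases "\<exists>g. ground B a g")
  case True
  then obtain g where "ground B a g" by blast
  with assms have "closed_exp (App f g)" using closed_ground by blast
  then have "closed_exp f" by (simp add: closed_exp_def)
  then show ?thesis using that assms gequiv_refl by blast
next
  case False
  \<comment> \<open>The condition on values is vacuous, so any closed expression will do.\<close>
  then show ?thesis using that[of "Lam (Idx 0)"] by (auto simp: closed_exp_def)
qed

text \<open>The eta-expansion of \<open>f\<close>, which a label for \<open>f\<close> denotes under
  its binder, acts as \<open>f\<close> does.\<close>

lemma reduces_beta_App: "closed_exp f \<Longrightarrow> reduces (App (Lam (App f (Idx 0))) u) (App f u)"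
  using reduces_beta[of "App f (Idx 0)" u] by (simp add: closed_exp_def open_exp_lc[of 0])

lemma is_term_const: "F \<in> \<Lambda> \<Longrightarrow> typ_entries (sym_type F) = [] \<Longrightarrow> is_term B \<Lambda> (Ap F [] [])"
  by (rule is_term.intros(3)) auto

lemma is_term_unary:
  assumes "F \<in> \<Lambda>" "typ_entries (sym_type F) = [E]" "is_term B \<Lambda> U" "term_type U = ent_type E"
    and "distinct \<xi>s" "map tvar_type \<xi>s = ent_hyps E"
    and "\<forall>\<xi> \<in> free_tvars U - set \<xi>s. fv (tvar_type \<xi>) \<inter> set (ent_vars E) = {}"
  shows "is_term B \<Lambda> (Ap F [\<xi>s] [U])"
  using assms by (intro is_term.intros(3)[of _ _ "[E]"]) auto

text \<open>A case distinction suffices in place of an induction: only the outermost operation is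
  analysed, and the components below it are hidden behind labels numbered from
  \<open>k\<close>.\<close>

lemma canonical_term_of_ground:
  assumes "base_on L B" "formula (base_lang B) a" "fv a = {}"
    and \<delta>: "denotation B \<Lambda> \<delta>" and "ground B a e"
  shows "\<exists>\<nu> U. new_labels B k \<nu> \<and> is_term B (ext_syms B \<Lambda> \<nu>) U \<and> closed_term U \<and> canonical U \<and>
    term_type U = a \<and> gequiv B a e (den_rhs (ext_den \<delta> \<nu>) U)"
  (is "\<exists>\<nu> U. ?P \<nu> U")
proof (cases a)
  case Falsum
  then show ?thesis using assms by simp
next
  case (Atom p ts)
  then obtain d where "computes e (Dat (Der d))" "closed_deriv B d" "concl d = Atom p ts"
    using assms(5) by auto
  then have "?P Map.empty (Cst d)"
    using Atom assms(3) \<delta>[unfolded denotation_def]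
    by (auto simp: new_labels_def closed_term_def ext_den_def intro: is_term.intros(1))
  then show ?thesis by blast
next
  case (Conj b c)
  obtain e1 e2 where e: "computes e (EAnd e1 e2)" "ground B b e1" "ground B c e2"
    using assms(5) Conj by auto
  \<comment> \<open>Two numbers keep the labels distinct even if \<open>b\<close> and
    \<open>c\<close> coincide and hence the types do.\<close>
  let ?F = "Lab k (const_type b)" and ?G = "Lab (Suc k) (const_type c)"
  let ?\<nu> = "[?F \<mapsto> e1, ?G \<mapsto> e2]"
  let ?U = "Ap (SAnd b c) [[], []] [Ap ?F [] [], Ap ?G [] []]"
  have "new_labels B k ?\<nu>"
    using assms Conj e by (auto simp: new_labels_def wf_const_type operation_const_type)
  moreover have "is_term B (ext_syms B \<Lambda> ?\<nu>) ?U"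
  proof (rule is_term.intros(3)[OF _ refl])
    have "is_term B (ext_syms B \<Lambda> ?\<nu>) (Ap ?F [] [])" "is_term B (ext_syms B \<Lambda> ?\<nu>) (Ap ?G [] [])"
      by (auto simp: ext_syms_def const_type_def intro!: is_term_const)
    then show "\<forall>U \<in> set [Ap ?F [] [], Ap ?G [] []]. is_term B (ext_syms B \<Lambda> ?\<nu>) U"
      by simp
  qed (use assms Conj in \<open>auto simp: ext_syms_def const_type_def less_Suc_eq\<close>)
  moreover have "gequiv B a e (den_rhs (ext_den \<delta> ?\<nu>) ?U)"
    using e(1) closed_ground[OF e(2)] closed_ground[OF e(3)] gequiv_refl[OF e(2)] gequiv_refl[OF e(3)]
    by (simp add: Conj ext_den_def lams_def plug_closed closed_exp_def) blast
  moreover have "closed_term ?U"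
    using assms Conj by (auto simp: closed_term_def const_type_def less_Suc_eq)
  ultimately have "?P ?\<nu> ?U" using Conj by simp
  then show ?thesis by blast
next
  case (Disj b c)
  \<comment> \<open>Both sides of \<or>I are treated together. Only entry 0 occurs in
    \<open>p\<close>, so a constant filling describes the denotation; \<open>V\<close> is arbitrary,
    as canonicity depends on the symbol alone.\<close>
  have unary: "\<exists>\<nu> U. ?P \<nu> U"
    if g: "ground B b' e'" and b': "formula (base_lang B) b'" "fv b' = {}"
      and F: "sym_type F = \<lparr>typ_inds = {}, typ_entries = [plain b'], typ_res = a\<rparr>"
        "primitive_op F = Some p" "wf_sym (base_lang B) F" "canonical (Ap F [[]] [V])"
      and eq: "gequiv B a e (plug (\<lambda>_. e') p)" "places p = {PEntry 0}" for b' e' F V p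
  proof -
    let ?G = "Lab k (const_type b')"
    let ?\<nu> = "[?G \<mapsto> e']" and ?U = "Ap F [[]] [Ap ?G [] []]"
    have "new_labels B k ?\<nu>"
      using g b' by (auto simp: new_labels_def wf_const_type operation_const_type)
    moreover have "is_term B (ext_syms B \<Lambda> ?\<nu>) ?U"
      by (rule is_term_unary[of _ _ "plain b'"])
        (use F in \<open>auto simp: ext_syms_def const_type_def intro!: is_term_const\<close>)
    moreover have "den_rhs (ext_den \<delta> ?\<nu>) ?U = plug (\<lambda>_. e') p"
      using closed_ground[OF g] F eq(2)
      by (auto simp: ext_den_def lams_def plug_closed closed_exp_def intro!: plug_cong)
    moreover have "closed_term ?U" "canonical ?U" "term_type ?U = a"
      using F by (auto simp: closed_term_def const_type_def)
    ultimately have "?P ?\<nu> ?U" using eq(1) by simp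
    then show ?thesis by blast
  qed
  consider e1 where "computes e (EOrL e1)" "ground B b e1"
    | e1 where "computes e (EOrR e1)" "ground B c e1"
    using assms(5) Disj by auto
  then show ?thesis
  proof cases
    case 1
    show ?thesis
      by (rule unary[OF 1(2), of "SOrL b c"]) (use 1 assms Disj gequiv_refl in auto)
  next
    case 2
    show ?thesis
      by (rule unary[OF 2(2), of "SOrR b c"]) (use 2 assms Disj gequiv_refl in auto)
  qed
next
  case (Impl b c)
  obtain f where f: "computes e (EImp f)" "\<forall>g. ground B b g \<longrightarrow> ground B c (App f g)"
    using assms(5) Impl by auto
  obtain f' where f': "closed_exp f'"
    and *: "\<And>g. ground B b g \<Longrightarrow> ground B c (App f' g) \<and> gequiv B c (App f g) (App f' g)"
    using closed_operation_of_ground_Impl[OF f(2)] by metis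
  \<comment> \<open>The label stands for the operation from grounds for \<open>b\<close> to grounds
    for \<open>c\<close>; applied to a typed variable which \<rightarrow>I binds, it yields the
    required component.\<close>
  let ?\<tau> = "\<lparr>typ_inds = {}, typ_entries = [plain b], typ_res = c\<rparr>"
  let ?F = "Lab k ?\<tau>" and ?\<xi> = "(0, b)"
  let ?\<nu> = "[?F \<mapsto> App f' (Place (PEntry 0))]"
  let ?U = "Ap (SImp b c) [[?\<xi>]] [Ap ?F [[]] [TVar ?\<xi>]]"
  have bc: "formula (base_lang B) b" "formula (base_lang B) c" "fv b = {}" "fv c = {}"
    using assms Impl by auto
  have "operation B ?\<tau> (App f' (Place (PEntry 0)))"
    using f' bc * by (auto simp: operation_def closed_exp_def list_all2_Cons1 plug_closed subst_closed)
  then have "new_labels B k ?\<nu>"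
    using bc by (auto simp: new_labels_def wf_optype_def ent_fv_def)
  moreover have inner: "is_term B (ext_syms B \<Lambda> ?\<nu>) (Ap ?F [[]] [TVar ?\<xi>])"
    by (rule is_term_unary[of _ _ "plain b"])
      (use bc in \<open>auto simp: ext_syms_def intro: is_term.intros(2)\<close>)
  have "is_term B (ext_syms B \<Lambda> ?\<nu>) ?U"
    by (rule is_term_unary[OF _ _ inner, of _ "\<lparr>ent_vars = [], ent_hyps = [b], ent_type = c\<rparr>"])
      (use bc in \<open>auto simp: ext_syms_def\<close>)
  moreover have "den_rhs (ext_den \<delta> ?\<nu>) ?U = EImp (Lam (App f' (Idx 0)))"
    using f' bc \<delta>[unfolded denotation_def]
    by (simp add: ext_den_def lams_def closed_exp_def plug_closed close_exp_fresh)
  then have "gequiv B a e (den_rhs (ext_den \<delta> ?\<nu>) ?U)"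
    using f(1) Impl * gequiv_reduces reduces_beta_App[OF f'] by auto blast
  moreover have "closed_term ?U"
    using bc by (auto simp: closed_term_def)
  ultimately have "?P ?\<nu> ?U" using Impl by simp
  then show ?thesis by blast
next
  case (Forall b)
  obtain f where f: "computes e (EAll f)"
    "\<forall>t \<in> individuals B. ground B (inst b t) (App f (Dat (Ind t)))"
    using assms(5) Forall by auto
  have b: "formula (base_lang B) (Forall b)" "fv b = {}"
    using assms Forall by auto
  \<comment> \<open>Unlike for implication, an argument always exists: the domain is inhabited, and
    \<open>f\<close> applied to an individual is a ground, hence closed.\<close>
  have "closed_exp f"
    using f(2) assms(1) closed_ground by (fastforce simp: base_on_def closed_exp_def)
  \<comment> \<open>As \<open>b\<close> has no free variables, variable 0 is fresh for it. It is the
    individual argument of the label and is then bound by \<forall>I.\<close>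
  let ?b = "inst b (Var 0)"
  let ?\<tau> = "\<lparr>typ_inds = {0}, typ_entries = [], typ_res = ?b\<rparr>"
  let ?F = "Lab k ?\<tau>"
  let ?\<nu> = "[?F \<mapsto> App f (Place (PInd 0))]"
  let ?U = "Ap (SAll 0 b) [[]] [Ap ?F [] []]"
  have "subst \<sigma> ?b = inst b (\<sigma> 0)" if "assignment B \<sigma>" for \<sigma>
    using subst_inst[OF that] b by (simp add: subst_closed)
  then have "operation B ?\<tau> (App f (Place (PInd 0)))"
    using \<open>closed_exp f\<close> f(2)
    by (auto simp: operation_def closed_exp_def plug_closed assignment_def)
  moreover have "wf_optype (base_lang B) ?\<tau>"
    using b fv_inst_fm[of 0 "Var 0" b] by (auto simp: wf_optype_def intro!: wf_inst_fm)
  ultimately have "new_labels B k ?\<nu>"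
    by (auto simp: new_labels_def)
  moreover have "is_term B (ext_syms B \<Lambda> ?\<nu>) ?U"
    by (rule is_term_unary[of _ _ "\<lparr>ent_vars = [0], ent_hyps = [], ent_type = ?b\<rparr>"])
      (use b in \<open>auto simp: ext_syms_def intro!: is_term_const\<close>)
  moreover have "den_rhs (ext_den \<delta> ?\<nu>) ?U = EAll (Lam (App f (Idx 0)))"
    using \<open>closed_exp f\<close>
    by (simp add: ext_den_def lams_def closed_exp_def plug_closed close_exp_fresh)
  then have "gequiv B a e (den_rhs (ext_den \<delta> ?\<nu>) ?U)"
    using f Forall gequiv_refl gequiv_reduces reduces_beta_App[OF \<open>closed_exp f\<close>] by auto blast
  moreover have "closed_term ?U"
    using b by (auto simp: closed_term_def)
  ultimately have "?P ?\<nu> ?U" using Forall by simp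
  then show ?thesis by blast
next
  case (Exists b)
  obtain w t g where g: "computes e (EEx w g)" "computes w (Dat (Ind t))" "t \<in> individuals B"
      "ground B (inst b t) g"
    using assms(5) Exists by auto
  have t: "wf_tm (base_lang B) 0 t" "fv_tm t = {}"
    using g(3) by (auto simp: individuals_def)
  have b: "formula (base_lang B) (Exists b)" "fv b = {}"
    using assms Exists by auto
  let ?b = "inst b t"
  have inst: "formula (base_lang B) ?b" "fv ?b = {}"
    using b t wf_inst_fm fv_inst_fm[of 0 t b] by auto
  let ?F = "Lab k (const_type ?b)"
  let ?\<nu> = "[?F \<mapsto> g]"
  let ?U = "Ap (SEx b t) [[]] [Ap ?F [] []]"
  have "new_labels B k ?\<nu>"
    using inst g by (auto simp: new_labels_def wf_const_type operation_const_type)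
  moreover have "is_term B (ext_syms B \<Lambda> ?\<nu>) ?U"
    by (rule is_term_unary[of _ _ "plain ?b"])
      (use b t in \<open>auto simp: ext_syms_def const_type_def intro!: is_term_const\<close>)
  moreover have "den_rhs (ext_den \<delta> ?\<nu>) ?U = EEx (tm_exp t) g"
    using closed_ground[OF g(4)] t
    by (simp add: ext_den_def lams_def plug_closed closed_exp_def)
  \<comment> \<open>The witness expression \<open>w\<close> is replaced by \<open>tm_exp t\<close>;
    equivalence requires only that both compute to the same individual.\<close>
  moreover have "computes (tm_exp t) (Dat (Ind t))"
  proof -
    let ?\<theta> = "case_plc (\<lambda>x. Dat (Ind (Var x))) (\<lambda>\<xi>. Place (PGr \<xi>)) (\<lambda>i. Place (PEntry i))"
    have "computes (plug ?\<theta> (tm_exp t)) (Dat (Ind (subst_tm Var t)))"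
      by (rule computes_tm_exp[OF t(1)]) simp
    then show ?thesis using t by (simp add: plug_closed)
  qed
  then have "gequiv B a e (EEx (tm_exp t) g)"
    using g(1,2) gequiv_refl[OF g(4)] by (simp add: Exists) blast
  moreover have "closed_term ?U"
    using b t by (auto simp: closed_term_def const_type_def)
  ultimately have "?P ?\<nu> ?U" using Exists by simp
  then show ?thesis by blast
qed

theorem theorem18:
  fixes L :: language and B :: base and \<Lambda>1 :: "opsym set"
    and \<delta>1 :: "letter \<Rightarrow> ex" and T :: gterm
  assumes K: "principle_K L"
    and "base_on L B"
    and "language_of_grounding B \<Lambda>1"
    and "denotation B \<Lambda>1 \<delta>1"
    and "is_term B \<Lambda>1 T"
    and "closed_term T"
  shows "\<exists>\<Lambda>2 \<delta>2.
    expansion B \<Lambda>1 \<Lambda>2 \<and> denotation B \<Lambda>2 \<delta>2 \<and>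
    op_ident (den \<delta>1 T) (den \<delta>2 T) \<and>
    closed_under_canonical_form B \<Lambda>2 \<delta>2 T"
proof -
  let ?a = "term_type T"
  obtain k where k: "\<And>\<nu>. new_labels B k \<nu> \<Longrightarrow> den_rhs (ext_den \<delta>1 \<nu>) T = den_rhs \<delta>1 T"
    using den_rhs_ext_den[OF assms(4,5)] by blast
  have closed: "fv ?a = {}"
    using fv_term_type[OF assms(3,5)] assms(6) by (auto simp: closed_term_def)
  have ground: "ground B ?a (den_rhs \<delta>1 T)"
    by (rule ground_closed_term[OF assms(2-6)])
  obtain \<nu> U where \<nu>: "new_labels B k \<nu>"
    and U: "is_term B (ext_syms B \<Lambda>1 \<nu>) U" "closed_term U" "canonical U" "term_type U = ?a"
    and eq: "gequiv B ?a (den_rhs \<delta>1 T) (den_rhs (ext_den \<delta>1 \<nu>) U)"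
    using canonical_term_of_ground[OF assms(2) formula_term_type[OF assms(2,3,5)] closed assms(4) ground]
    by blast
  let ?\<Lambda>2 = "ext_syms B \<Lambda>1 \<nu>" and ?\<delta>2 = "ext_den \<delta>1 \<nu>"
  have exp: "expansion B \<Lambda>1 ?\<Lambda>2" by (rule expansion_ext_syms[OF assms(3) \<nu>])
  have den: "denotation B ?\<Lambda>2 ?\<delta>2" by (rule denotation_ext_den[OF assms(4) \<nu>])
  \<comment> \<open>The types and free variables depend on T alone, and the right-hand side is
    unchanged by the choice of \<open>k\<close>.\<close>
  have "den \<delta>1 T = den ?\<delta>2 T" by (simp add: den_def k[OF \<nu>])
  moreover have "places (den_rhs ?\<delta>2 U) = {}"
    using ground_closed_term[OF assms(2) _ den U(1,2)] exp closed_ground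
    by (auto simp: expansion_def closed_exp_def)
  then have "op_equiv B (den ?\<delta>2 T) (den ?\<delta>2 U)"
    using closed assms(6) U eq closed_ground[OF ground] k[OF \<nu>]
    by (intro op_equiv_closed_terms) (auto simp: closed_exp_def)
  ultimately show ?thesis
    using exp den U op_ident_refl unfolding closed_under_canonical_form_def by metis
qed

end
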